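(* Let $n\ge 3$, let $C$ be a real symmetric positive definite $n\times n$ matrix with distinct eigenvalues, and let $\nu\ge 0$. Then there exists a pair of directions $G^1,G^2\in so(n)$ (depending on $C$) such that the control system on $so(n)$ $$\dot\Omega=\mathcal I_C^{-1}[C,\Omega^2]-\nu\,\Omega+G^1u_1(t)+G^2u_2(t)$$ with scalar controls $u_1(t),u_2(t)$ is globally controllable.
   Context: $so(n)$ is the space of real skew-symmetric $n\times n$ matrices and $[\cdot,\cdot]$ is the matrix commutator. For $C$ symmetric positive definite, the inertia operator $\mathcal I_C: so(n)\to so(n)$, $\mathcal I_C\Omega=\Omega C+C\Omega$, is an invertible linear map; for $\Omega\in so(n)$ the matrix $[C,\Omega^2]$ is skew-symmetric, so $\mathcal I_C^{-1}[C,\Omega^2]$ is well defined. The system describes the controlled rotation of a multidimensional rigid body, with damping coefficient $\nu$. Global controllability means: for any $\tilde\Omega,\hat\Omega\in so(n)$ the system can be steered from $\tilde\Omega$ to $\hat\Omega$ in some time $T\ge 0$. *)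

theory Defs
  imports "HOL-Analysis.Analysis"
begin

definition so :: "(real^'n^'n) set"
  where "so = {A. transpose A = - A}"

definition commutator :: "real^'n^'n \<Rightarrow> real^'n^'n \<Rightarrow> real^'n^'n"
  where "commutator A B = A ** B - B ** A"

definition sym_pos_def :: "real^'n^'n \<Rightarrow> bool"
  where "sym_pos_def C \<longleftrightarrow> transpose C = C \<and> (\<forall>x. x \<noteq> 0 \<longrightarrow> x \<bullet> (C *v x) > 0)"

definition eigenvalues :: "real^'n^'n \<Rightarrow> real set"
  where "eigenvalues C = {l. \<exists>v. v \<noteq> 0 \<and> C *v v = l *\<^sub>R v}"

text \<open>All \<open>n\<close> eigenvalues are distinct, i.e. there are \<open>n\<close> different real eigenvalues.\<close>

definition distinct_eigenvalues :: "real^'n^'n \<Rightarrow> bool"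
  where "distinct_eigenvalues C \<longleftrightarrow> card (eigenvalues C) = CARD('n)"

definition inertia :: "real^'n^'n \<Rightarrow> real^'n^'n \<Rightarrow> real^'n^'n"
  where "inertia C \<Omega> = \<Omega> ** C + C ** \<Omega>"

text \<open>The inverse is that of the restriction of \<open>inertia C\<close> to \<open>so\<close>, which is a bijection
  of \<open>so\<close> onto itself for positive definite \<open>C\<close> (\<open>bij_betw_inertia\<close> below).\<close>

definition inertia_inv :: "real^'n^'n \<Rightarrow> real^'n^'n \<Rightarrow> real^'n^'n"
  where "inertia_inv C = inv_into so (inertia C)"

definition rigid_body_drift :: "real^'n^'n \<Rightarrow> real \<Rightarrow> real^'n^'n \<Rightarrow> real^'n^'n"
  where "rigid_body_drift C \<nu> \<Omega> = inertia_inv C (commutator C (\<Omega> ** \<Omega>)) - \<nu> *\<^sub>R \<Omega>"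

text \<open>Admissible controls on \<open>[0, T]\<close> are the bounded measurable functions.\<close>

definition admissible_control :: "real \<Rightarrow> (real \<Rightarrow> real) \<Rightarrow> bool"
  where "admissible_control T u \<longleftrightarrow>
    u \<in> borel_measurable (lebesgue_on {0..T}) \<and> bounded (u ` {0..T})"

text \<open>Caratheodory solutions in \<open>X\<close> on \<open>[0, T]\<close> of \<open>x' = f x + u1(t) g1 + u2(t) g2\<close>, as
  continuous solutions of the equivalent integral equation.\<close>

definition controlled_trajectory ::
  "'a::euclidean_space set \<Rightarrow> ('a \<Rightarrow> 'a) \<Rightarrow> 'a \<Rightarrow> 'a \<Rightarrow> real \<Rightarrow> (real \<Rightarrow> real) \<Rightarrow> (real \<Rightarrow> real)
    \<Rightarrow> (real \<Rightarrow> 'a) \<Rightarrow> bool"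
  where "controlled_trajectory X f g1 g2 T u1 u2 x \<longleftrightarrow>
    continuous_on {0..T} x \<and> x ` {0..T} \<subseteq> X \<and>
    (\<forall>t\<in>{0..T}. ((\<lambda>s. f (x s) + u1 s *\<^sub>R g1 + u2 s *\<^sub>R g2) has_integral (x t - x 0)) {0..t})"

definition globally_controllable ::
  "'a::euclidean_space set \<Rightarrow> ('a \<Rightarrow> 'a) \<Rightarrow> 'a \<Rightarrow> 'a \<Rightarrow> bool"
  where "globally_controllable X f g1 g2 \<longleftrightarrow>
    (\<forall>a\<in>X. \<forall>b\<in>X. \<exists>T\<ge>0. \<exists>u1 u2 x.
      admissible_control T u1 \<and> admissible_control T u2 \<and>
      controlled_trajectory X f g1 g2 T u1 u2 x \<and> x 0 = a \<and> x T = b)"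

lemma transpose_plus: "transpose (A + B) = transpose A + transpose (B :: real^'n^'m)"
  and transpose_diff: "transpose (A - B) = transpose A - transpose B"
  by (simp_all add: transpose_def vec_eq_iff)

lemma matrix_mul_uminus: "(- A) ** B = - (A ** B)" "A ** (- B) = - (A ** B)"
  for A B :: "real^'n^'n"
  by (simp_all add: matrix_matrix_mult_def vec_eq_iff sum_negf)

lemma matrix_add_rdist: "(A + B) ** C = A ** C + B ** C" for A B C :: "real^'n^'n"
  by (simp add: matrix_matrix_mult_def vec_eq_iff sum.distrib algebra_simps)

lemma subspace_so: "subspace so"
  by (auto simp: subspace_def so_def transpose_plus transpose_scalar)
     (simp add: transpose_def vec_eq_iff)

lemma commutator_sq_in_so:
  assumes "sym_pos_def C" "\<Omega> \<in> so"
  shows "commutator C (\<Omega> ** \<Omega>) \<in> so"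
  using assms
  by (simp add: so_def sym_pos_def_def commutator_def transpose_diff matrix_transpose_mul
      matrix_mul_uminus)

lemma inertia_in_so:
  assumes "sym_pos_def C" "\<Omega> \<in> so"
  shows "inertia C \<Omega> \<in> so"
  using assms
  by (simp add: so_def sym_pos_def_def inertia_def transpose_plus matrix_transpose_mul
      matrix_mul_uminus)

lemma linear_inertia: "linear (inertia C)"
  by (rule linearI)
     (simp_all add: inertia_def vec_eq_iff matrix_matrix_mult_def sum_distrib_left sum.distrib
        algebra_simps)

lemma inertia_eq_0_imp:
  fixes C \<Omega> :: "real^'n^'n"
  assumes C: "sym_pos_def C" and \<Omega>: "\<Omega> \<in> so" and 0: "inertia C \<Omega> = 0"
  shows "\<Omega> = 0"
proof -
  have sk: "transpose \<Omega> = - \<Omega>" using \<Omega> by (simp add: so_def)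
  have tr: "trace (\<Omega> ** C ** transpose \<Omega>) = (\<Sum>i\<in>UNIV. row i \<Omega> \<bullet> (C *v row i \<Omega>))"
    unfolding matrix_mul_assoc[symmetric]
    by (simp add: trace_def matrix_matrix_mult_def inner_vec_def
        matrix_vector_mult_def transpose_def row_def)
  have "trace (C ** \<Omega> ** transpose \<Omega>) = trace (transpose \<Omega> ** (C ** \<Omega>))"
    by (rule trace_mul_sym)
  also have "\<dots> = trace (\<Omega> ** C ** transpose \<Omega>)"
    by (simp add: sk matrix_mul_uminus matrix_mul_assoc)
  finally have "2 * trace (\<Omega> ** C ** transpose \<Omega>) = trace (inertia C \<Omega> ** transpose \<Omega>)"
    by (simp add: inertia_def matrix_add_rdist trace_add)
  moreover have "trace (inertia C \<Omega> ** transpose \<Omega>) = 0"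
    by (simp add: 0 trace_def matrix_matrix_mult_def)
  ultimately have "(\<Sum>i\<in>UNIV. row i \<Omega> \<bullet> (C *v row i \<Omega>)) = 0"
    using tr by linarith
  moreover have nn: "x \<bullet> (C *v x) \<ge> 0" for x
    using C by (cases "x = 0") (auto simp: sym_pos_def_def less_imp_le)
  ultimately have "row i \<Omega> \<bullet> (C *v row i \<Omega>) = 0" for i
    by (simp add: sum_nonneg_eq_0_iff)
  then have "row i \<Omega> = 0" for i
    using C unfolding sym_pos_def_def by (metis less_irrefl)
  then show ?thesis by (simp add: row_def vec_eq_iff)
qed

lemma bij_betw_inertia:
  fixes C :: "real^'n^'n"
  assumes "sym_pos_def C"
  shows "bij_betw (inertia C) so so"
proof -
  have inj: "inj_on (inertia C) so"
    using linear_injective_on_subspace_0[OF linear_inertia subspace_so, of C]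
      inertia_eq_0_imp[OF assms] by blast
  have sub: "inertia C ` so \<subseteq> so" using inertia_in_so[OF assms] by blast
  have "span so = (so :: (real^'n^'n) set)" by (simp add: subspace_so)
  then have "dim (inertia C ` so) = dim (so :: (real^'n^'n) set)"
    using dim_image_eq[OF linear_inertia, of C so] inj by (metis (no_types))
  then have "inertia C ` so = so"
    using subspace_dim_equal[OF linear_subspace_image[OF linear_inertia subspace_so] subspace_so sub]
    by simp
  with inj show ?thesis by (simp add: bij_betw_def)
qed

end

theory Submission
  imports Defs
begin

text \<open>
  Controls of size \<open>1/t\<close> acting for a short time \<open>t\<close> move the state by almost exactly a multiple of \<open>g1\<close>
  or \<open>g2\<close>. Let \<open>J\<close> be the set of directions along which such jumps are possible up to an
  arbitrarily small error, uniformly on compact sets and continuously in the size of the jump. It is a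
  subspace. For the quadratic drift \<open>b x x + l x\<close>, if \<open>g, w \<in> J\<close> and \<open>b g g = 0\<close>, then a far jump
  along \<open>g\<close> and \<open>w\<close>, a short drift, and the jump back amount to a jump along \<open>b g w + b w g\<close>, which
  therefore lies in \<open>J\<close>. Once \<open>J\<close> is everything, every target is reached up to an error of \<open>1\<close> by a
  family of controls on which the endpoint depends continuously, and Brouwer's theorem gives exact
  steering.

  In an orthonormal eigenbasis of \<open>C\<close> with eigenvalues \<open>c\<^sub>i\<close> put \<open>E\<^sub>i\<^sub>j = e\<^sub>i \<and> e\<^sub>j\<close>. These satisfy
  \<open>b E\<^sub>i\<^sub>j E\<^sub>i\<^sub>j = 0\<close>, and the symmetrized \<open>b E\<^sub>i\<^sub>j E\<^sub>j\<^sub>k\<close> is \<open>\<beta>\<^sub>i\<^sub>k E\<^sub>i\<^sub>k\<close> with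
  \<open>\<beta>\<^sub>i\<^sub>k = (c\<^sub>i - c\<^sub>k) / (c\<^sub>i + c\<^sub>k)\<close>. Let \<open>c\<^sub>1, c\<^sub>2\<close> be the two largest eigenvalues, and
  \<open>G1 = E\<^sub>1\<^sub>2\<close>, \<open>G2 = \<Sum>\<^sub>k E\<^sub>1\<^sub>k\<close> over the other \<open>k\<close>. Applying \<open>X \<mapsto> b G1 X + b X G1\<close> twice multiplies
  \<open>E\<^sub>1\<^sub>k\<close> by \<open>- \<beta>\<^sub>1\<^sub>k \<beta>\<^sub>2\<^sub>k\<close>. These factors are distinct: equality for \<open>k \<noteq> m\<close> would force
  \<open>c\<^sub>k c\<^sub>m = c\<^sub>1 c\<^sub>2\<close>. Hence every \<open>E\<^sub>1\<^sub>k\<close> lies in \<open>J\<close>, and with them all \<open>E\<^sub>i\<^sub>j\<close>.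
\<close>

section \<open>Solutions over short times\<close>

text \<open>Banach's fixed point theorem for the integral operator on bounded continuous functions
  on the whole line; \<open>t * L\<close> is the contraction factor.\<close>

lemma picard_solution:
  fixes F :: "'a::euclidean_space \<Rightarrow> 'a"
  assumes lip: "L-lipschitz_on UNIV F" and t: "0 \<le> t" "t * L < 1"
  shows "\<exists>y. continuous_on {0..t} y \<and> y 0 = x \<and>
    (\<forall>\<tau>\<in>{0..t}. ((\<lambda>s. F (y s)) has_integral (y \<tau> - x)) {0..\<tau>})"
proof -
  have L: "L \<ge> 0" using lip lipschitz_on_nonneg by blast
  have F: "continuous_on S F" for S
    using lipschitz_on_continuous_on[OF lip] continuous_on_subset by blast
  have Fb: "continuous_on S (\<lambda>s. F (apply_bcontfun y s))" for S and y :: "real \<Rightarrow>\<^sub>C 'a"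
    using continuous_on_compose2[OF F[of UNIV], of S "apply_bcontfun y"] by auto
  define I where "I = (\<lambda>(y :: real \<Rightarrow>\<^sub>C 'a) \<tau>. x + integral {0..\<tau>} (\<lambda>s. F (apply_bcontfun y s)))"
  have int: "((\<lambda>s. F (apply_bcontfun y s)) has_integral (I y \<tau> - x)) {0..\<tau>}" for y \<tau>
    using integrable_integral[OF integrable_continuous_real[OF Fb]] by (simp add: I_def)
  have contI: "continuous_on {0..t} (I y)" for y
    unfolding I_def
    by (intro continuous_intros indefinite_integral_continuous_1 integrable_continuous_real Fb)
  \<comment> \<open>Freezing \<open>I y\<close> outside \<open>{0..t}\<close> by
    \<open>clamp\<close> makes \<open>P\<close> a self-map of the bounded continuous functions; its
    fixed point solves the integral equation on \<open>{0..t}\<close>.\<close>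
  define P where "P = (\<lambda>y. Bcontfun (\<lambda>\<tau>. I y (clamp 0 t \<tau>)))"
  have clamp: "clamp 0 t \<tau> \<in> {0..t}" for \<tau>
    using clamp_in_interval[of 0 t \<tau>] t by (simp add: cbox_interval)
  have Pin: "(\<lambda>\<tau>. I y (clamp 0 t \<tau>)) \<in> bcontfun" for y
  proof -
    have "continuous_on UNIV (\<lambda>\<tau>. I y (clamp 0 t \<tau>))"
      using clamp_continuous_on[of 0 t "I y" UNIV] contI by (simp add: cbox_interval)
    moreover have "bounded (range (\<lambda>\<tau>. I y (clamp 0 t \<tau>)))"
      by (rule bounded_subset[OF compact_imp_bounded[OF compact_continuous_image[OF contI compact_Icc]]])
        (use clamp in auto)
    ultimately show ?thesis by (simp add: bcontfun_def)
  qed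
  have P: "apply_bcontfun (P y) \<tau> = I y (clamp 0 t \<tau>)" for y \<tau>
    using Bcontfun_inverse[OF Pin] by (simp add: P_def)
  have "dist (P y) (P z) \<le> (t * L) * dist y z" for y z
  proof (rule dist_bound)
    fix \<tau>
    let ?T = "clamp 0 t \<tau>"
    have T: "0 \<le> ?T" "?T \<le> t" using clamp[of \<tau>] by auto
    have "((\<lambda>s. F (apply_bcontfun y s) - F (apply_bcontfun z s)) has_integral
        ((I y ?T - x) - (I z ?T - x))) {0..?T}"
      by (intro has_integral_diff int)
    then have "norm ((I y ?T - x) - (I z ?T - x)) \<le> (L * dist y z) * measure lborel {0..?T}"
    proof (rule has_integral_bound_real[where S = "{}", rotated 2])
      fix s
      have "norm (F (apply_bcontfun y s) - F (apply_bcontfun z s))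
          \<le> L * dist (apply_bcontfun y s) (apply_bcontfun z s)"
        using lipschitz_onD[OF lip, of "apply_bcontfun y s" "apply_bcontfun z s"]
        by (simp add: dist_norm)
      also have "\<dots> \<le> L * dist y z" by (intro mult_left_mono dist_bounded L)
      finally show "norm (F (apply_bcontfun y s) - F (apply_bcontfun z s)) \<le> L * dist y z" .
    qed (use L in auto)
    also have "\<dots> \<le> (L * dist y z) * t"
      using T L by (intro mult_left_mono) auto
    finally show "dist (apply_bcontfun (P y) \<tau>) (apply_bcontfun (P z) \<tau>) \<le> t * L * dist y z"
      by (simp add: P dist_norm mult_ac)
  qed
  then obtain y where y: "P y = y"
    using banach_fix_type[of "t * L" P] t L by auto
  have yI: "apply_bcontfun y \<tau> = I y \<tau>" if "\<tau> \<in> {0..t}" for \<tau>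
    using P[of y \<tau>] y that by (simp add: clamp_cancel_cbox cbox_interval)
  show ?thesis
  proof (intro exI conjI ballI)
    show "continuous_on {0..t} (apply_bcontfun y)" by simp
    show "apply_bcontfun y 0 = x" using yI[of 0] t by (simp add: I_def)
    show "((\<lambda>s. F (apply_bcontfun y s)) has_integral (apply_bcontfun y \<tau> - x)) {0..\<tau>}"
      if "\<tau> \<in> {0..t}" for \<tau>
      using int[of y \<tau>] yI[OF that] by simp
  qed
qed

text \<open>In place of Gronwall's inequality: at a time \<open>\<sigma>\<close> of largest distance
  the integral equations bound this distance by half of itself plus the difference of the data,
  whence the factor \<open>2\<close>.\<close>

lemma solutions_close:
  fixes F :: "'a::euclidean_space \<Rightarrow> 'a"
  assumes lip: "L-lipschitz_on UNIV F" and t: "0 \<le> t" "t * L \<le> 1/2"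
    and y: "continuous_on {0..t} y"
      "\<And>\<tau>. \<tau> \<in> {0..t} \<Longrightarrow> ((\<lambda>s. F (y s) + c) has_integral (y \<tau> - x)) {0..\<tau>}"
    and z: "continuous_on {0..t} z"
      "\<And>\<tau>. \<tau> \<in> {0..t} \<Longrightarrow> ((\<lambda>s. F (z s) + c') has_integral (z \<tau> - x')) {0..\<tau>}"
    and \<tau>: "\<tau> \<in> {0..t}"
  shows "norm (y \<tau> - z \<tau>) \<le> 2 * (norm (x - x') + t * norm (c - c'))"
proof -
  have L: "L \<ge> 0" using lip lipschitz_on_nonneg by blast
  obtain \<sigma> where \<sigma>: "\<sigma> \<in> {0..t}" and max: "\<And>s. s \<in> {0..t} \<Longrightarrow> norm (y s - z s) \<le> norm (y \<sigma> - z \<sigma>)"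
    using continuous_attains_sup[OF compact_Icc _ continuous_on_norm[OF continuous_on_diff[OF y(1) z(1)]]] t
    by fastforce
  let ?m = "norm (y \<sigma> - z \<sigma>)"
  have "((\<lambda>s. (F (y s) + c) - (F (z s) + c')) has_integral ((y \<sigma> - x) - (z \<sigma> - x'))) {0..\<sigma>}"
    by (intro has_integral_diff y z \<sigma>)
  then have "norm ((y \<sigma> - x) - (z \<sigma> - x')) \<le> (L * ?m + norm (c - c')) * measure lborel {0..\<sigma>}"
  proof (rule has_integral_bound_real[where S = "{}", rotated 2])
    fix s assume s: "s \<in> {0..\<sigma>} - {}"
    have "norm ((F (y s) + c) - (F (z s) + c')) \<le> norm (F (y s) - F (z s)) + norm (c - c')"
      by (metis add_diff_add norm_triangle_ineq)
    also have "norm (F (y s) - F (z s)) \<le> L * norm (y s - z s)"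
      using lipschitz_onD[OF lip, of "y s" "z s"] by (simp add: dist_norm)
    also have "\<dots> \<le> L * ?m" using s \<sigma> by (intro mult_left_mono max L) auto
    finally show "norm ((F (y s) + c) - (F (z s) + c')) \<le> L * ?m + norm (c - c')" by simp
  qed (use L in auto)
  also have "\<dots> \<le> (L * ?m + norm (c - c')) * t"
    using \<sigma> L by (intro mult_left_mono) auto
  also have "\<dots> = (t * L) * ?m + t * norm (c - c')" by (simp add: algebra_simps)
  also have "\<dots> \<le> 1/2 * ?m + t * norm (c - c')" using t by (intro add_mono mult_right_mono) auto
  finally have 1: "norm ((y \<sigma> - x) - (z \<sigma> - x')) \<le> 1/2 * ?m + t * norm (c - c')" .
  have "?m \<le> norm ((y \<sigma> - x) - (z \<sigma> - x')) + norm (x - x')"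
    using norm_triangle_ineq[of "(y \<sigma> - x) - (z \<sigma> - x')" "x - x'"] by (simp add: algebra_simps)
  with 1 max[OF \<tau>] show ?thesis by argo
qed

text \<open>Here \<open>d\<close> is the expected velocity and \<open>\<delta>\<close> its error,
  controlled only on a ball around \<open>x\<close>. Comparison with a constant curve shows that the
  solution never leaves that ball, so the velocity error can be integrated.\<close>

lemma solution_near_start:
  fixes F :: "'a::euclidean_space \<Rightarrow> 'a"
  assumes lip: "L-lipschitz_on UNIV F" and t: "0 \<le> t" "t * L \<le> 1/2"
    and y: "continuous_on {0..t} y"
      "\<And>\<tau>. \<tau> \<in> {0..t} \<Longrightarrow> ((\<lambda>s. F (y s) + c) has_integral (y \<tau> - x)) {0..\<tau>}"
    and near: "\<And>z. norm (z - x) \<le> 2 * t * (norm d + \<delta>) \<Longrightarrow> norm (F z + c - d) \<le> \<delta>"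
    and \<delta>: "\<delta> \<ge> 0"
  shows "\<tau> \<in> {0..t} \<Longrightarrow> norm (y \<tau> - x) \<le> 2 * t * (norm d + \<delta>)"
    and "norm (y t - (x + t *\<^sub>R d)) \<le> t * \<delta>"
proof -
  have "norm (F x + c) \<le> norm d + norm (F x + c - d)" by norm
  also have "norm (F x + c - d) \<le> \<delta>" using near[of x] t \<delta> by simp
  finally have Fx: "norm (F x + c) \<le> norm d + \<delta>" by simp
  show st: "norm (y \<tau> - x) \<le> 2 * t * (norm d + \<delta>)" if "\<tau> \<in> {0..t}" for \<tau>
  proof -
    \<comment> \<open>The constant curve \<open>x\<close> solves the equation with forcing
      \<open>- F x\<close>, which cancels its velocity.\<close>
    have "norm (y \<tau> - x) \<le> 2 * (norm (x - x) + t * norm (c - (- F x)))"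
      by (rule solutions_close[OF lip t y _ _ that, where z = "\<lambda>_. x" and x' = x and c' = "- F x"])
         auto
    also have "\<dots> \<le> 2 * (t * (norm d + \<delta>))"
      using Fx t by (auto intro!: mult_left_mono simp: add.commute)
    finally show ?thesis by simp
  qed
  have "((\<lambda>s. (F (y s) + c) - d) has_integral ((y t - x) - t *\<^sub>R d)) {0..t}"
    using y(2)[of t] t has_integral_const_real[of d 0 t]
    by (intro has_integral_diff) auto
  then have "norm ((y t - x) - t *\<^sub>R d) \<le> \<delta> * measure lborel {0..t}"
    by (rule has_integral_bound_real[where S = "{}", rotated 2]) (use \<delta> near st in auto)
  then show "norm (y t - (x + t *\<^sub>R d)) \<le> t * \<delta>"
    using t by (simp add: algebra_simps)
qed

section \<open>Steering and concatenation of controls\<close>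

text \<open>Controls are bounded Borel functions on the whole line and states range over the whole
  space, which keeps concatenation simple; \<open>trajectory_in_subspace\<close> later confines the
  trajectories to \<open>X\<close>.\<close>

definition steers ::
  "('a::euclidean_space \<Rightarrow> 'a) \<Rightarrow> 'a \<Rightarrow> 'a \<Rightarrow> 'a \<Rightarrow> 'a \<Rightarrow> bool" where
  "steers f g1 g2 x y \<longleftrightarrow> (\<exists>T\<ge>0. \<exists>u1 u2 z.
     u1 \<in> borel_measurable borel \<and> u2 \<in> borel_measurable borel \<and>
     bounded (range u1) \<and> bounded (range u2) \<and>
     controlled_trajectory UNIV f g1 g2 T u1 u2 z \<and> z 0 = x \<and> z T = y)"

lemma steers_trans:
  assumes "steers f g1 g2 x y" "steers f g1 g2 y w"
  shows "steers f g1 g2 x w"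
proof -
  obtain T u1 u2 z where T: "T \<ge> 0" and
    u: "u1 \<in> borel_measurable borel" "u2 \<in> borel_measurable borel"
      "bounded (range u1)" "bounded (range u2)" and
    tr: "controlled_trajectory UNIV f g1 g2 T u1 u2 z" "z 0 = x" "z T = y"
    using assms(1) unfolding steers_def by blast
  obtain T' u1' u2' z' where T': "T' \<ge> 0" and
    u': "u1' \<in> borel_measurable borel" "u2' \<in> borel_measurable borel"
      "bounded (range u1')" "bounded (range u2')" and
    tr': "controlled_trajectory UNIV f g1 g2 T' u1' u2' z'" "z' 0 = y" "z' T' = w"
    using assms(2) unfolding steers_def by blast
  define cat :: "(real \<Rightarrow> real) \<Rightarrow> (real \<Rightarrow> real) \<Rightarrow> real \<Rightarrow> real"
    where "cat = (\<lambda>a b s. if s \<le> T then a s else b (s - T))"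
  define Z where "Z = (\<lambda>s. if s \<le> T then z s else z' (s - T))"
  have cat_m: "cat a b \<in> borel_measurable borel"
    if "a \<in> borel_measurable borel" "b \<in> borel_measurable borel" for a b
    unfolding cat_def using that by measurable
  have cat_b: "bounded (range (cat a b))" if "bounded (range a)" "bounded (range b)" for a b
    by (rule bounded_subset[OF bounded_Un[THEN iffD2, OF conjI, OF that]]) (auto simp: cat_def)
  have cont: "continuous_on {0..T+T'} Z"
  proof -
    have "continuous_on ({0..T} \<union> {T..T+T'}) Z"
      unfolding Z_def
    proof (rule continuous_on_If)
      show "continuous_on {0..T} z" using tr(1) by (simp add: controlled_trajectory_def)
      show "continuous_on {T..T+T'} (\<lambda>s. z' (s - T))"
        by (rule continuous_on_compose2[of "{0..T'}" z'])
           (use tr'(1) in \<open>auto simp: controlled_trajectory_def intro!: continuous_intros\<close>)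
    qed (use tr tr' T in \<open>auto simp: antisym\<close>)
    then show ?thesis using T T' by (simp add: ivl_disj_un)
  qed
  let ?h = "\<lambda>s. f (z s) + u1 s *\<^sub>R g1 + u2 s *\<^sub>R g2"
  let ?h' = "\<lambda>s. f (z' s) + u1' s *\<^sub>R g1 + u2' s *\<^sub>R g2"
  let ?H = "\<lambda>s. f (Z s) + cat u1 u1' s *\<^sub>R g1 + cat u2 u2' s *\<^sub>R g2"
  have H1: "(?H has_integral (z \<tau> - x)) {0..\<tau>}" if "\<tau> \<in> {0..T}" for \<tau>
  proof -
    have "(?h has_integral (z \<tau> - x)) {0..\<tau>}"
      using tr that by (auto simp: controlled_trajectory_def)
    moreover have "?h s = ?H s" if "s \<in> {0..\<tau>}" for s
      using that \<open>\<tau> \<in> {0..T}\<close> by (auto simp: Z_def cat_def)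
    ultimately show ?thesis using has_integral_cong[of "{0..\<tau>}" ?h ?H] by blast
  qed
  have H2: "(?H has_integral (z' (\<tau> - T) - y)) {T..\<tau>}" if "\<tau> \<in> {T..T+T'}" for \<tau>
  proof -
    have "(?h' has_integral (z' (\<tau> - T) - y)) {0..\<tau>-T}"
      using tr' that by (auto simp: controlled_trajectory_def)
    then have "((\<lambda>s. ?h' (s - T)) has_integral (z' (\<tau> - T) - y)) {T..\<tau>}"
      using has_integral_shift_real_ivl[of ?h' _ 0 "\<tau> - T" "-T"] by simp
    \<comment> \<open>At the junction \<open>T\<close> the concatenated control still has its first
      value, so the integrands may differ at this one point, which the integral ignores.\<close>
    moreover have "?h' (s - T) = ?H s" if "s \<in> {T..\<tau>} - {T}" for s
      using that by (auto simp: Z_def cat_def)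
    ultimately show ?thesis
      using has_integral_spike_finite[of "{T}" "{T..\<tau>}" ?H "\<lambda>s. ?h' (s - T)"] by auto
  qed
  have ZT: "Z 0 = x" "Z (T + T') = w"
    using T T' tr tr' by (auto simp: Z_def)
  have "(?H has_integral (Z \<tau> - Z 0)) {0..\<tau>}" if "\<tau> \<in> {0..T+T'}" for \<tau>
  proof (cases "\<tau> \<le> T")
    case True
    then show ?thesis using H1[of \<tau>] that ZT(1) by (auto simp: Z_def)
  next
    case False
    have "(?H has_integral ((z T - x) + (z' (\<tau> - T) - y))) {0..\<tau>}"
      by (rule has_integral_combine[of 0 T]) (use False T that H1[of T] H2[of \<tau>] in auto)
    then show ?thesis using False ZT tr(3) by (simp add: Z_def)
  qed
  then have "controlled_trajectory UNIV f g1 g2 (T + T') (cat u1 u1') (cat u2 u2') Z"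
    using cont by (auto simp: controlled_trajectory_def)
  then show ?thesis
    unfolding steers_def using T T' ZT cat_m[OF u(1) u'(1)] cat_m[OF u(2) u'(2)]
      cat_b[OF u(3) u'(3)] cat_b[OF u(4) u'(4)]
    by (intro exI[of _ "T + T'"] conjI exI[of _ "cat u1 u1'"] exI[of _ "cat u2 u2'"] exI[of _ Z]) auto
qed

section \<open>Approximate jumps\<close>

text \<open>Composing \<open>f\<close> with the projection onto the ball gives a globally Lipschitz
  field, so the endpoint \<open>Y\<close> at time \<open>t\<close> is defined and continuous for
  every start and every constant control vector. The radius condition keeps the solution inside the
  ball, where it is a trajectory of \<open>f\<close> itself.\<close>

lemma local_flow:
  fixes f :: "'a::euclidean_space \<Rightarrow> 'a"
  assumes lip: "L-lipschitz_on (cball 0 \<rho>) f" and \<rho>: "\<rho> \<ge> 0" and t: "t \<ge> 0" "t * L \<le> 1/2"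
  obtains Y :: "'a \<Rightarrow> 'a \<Rightarrow> 'a" where
    "continuous_on UNIV (\<lambda>q. Y (fst q) (snd q))"
    "\<And>x a1 a2 d \<delta>. \<delta> \<ge> 0 \<Longrightarrow> norm x + 2 * t * (norm d + \<delta>) \<le> \<rho> \<Longrightarrow>
      (\<And>z. norm (z - x) \<le> 2 * t * (norm d + \<delta>) \<Longrightarrow> norm (f z + (a1 *\<^sub>R g1 + a2 *\<^sub>R g2) - d) \<le> \<delta>) \<Longrightarrow>
      steers f g1 g2 x (Y x (a1 *\<^sub>R g1 + a2 *\<^sub>R g2)) \<and>
      norm (Y x (a1 *\<^sub>R g1 + a2 *\<^sub>R g2) - (x + t *\<^sub>R d)) \<le> t * \<delta>"
proof -
  define F where "F = f \<circ> closest_point (cball 0 \<rho>)"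
  have "1-lipschitz_on UNIV (closest_point (cball (0::'a) \<rho>))"
    using \<rho> closest_point_lipschitz[of "cball (0::'a) \<rho>"] by (auto intro!: lipschitz_onI)
  moreover have "L-lipschitz_on (closest_point (cball 0 \<rho>) ` UNIV) f"
    using \<rho> closest_point_in_set[of "cball (0::'a) \<rho>"] by (intro lipschitz_on_subset[OF lip]) auto
  ultimately have Flip: "L-lipschitz_on UNIV F"
    unfolding F_def using lipschitz_on_compose by fastforce
  have FL: "L-lipschitz_on UNIV (\<lambda>x. F x + c)" for c
    using Flip by (auto simp: lipschitz_on_def)
  have Ff: "F z = f z" if "norm z \<le> \<rho>" for z
    using that by (simp add: F_def closest_point_self)
  define sol where "sol = (\<lambda>x c y. continuous_on {0..t} y \<and> y 0 = x \<and>
    (\<forall>\<tau>\<in>{0..t}. ((\<lambda>s. F (y s) + c) has_integral (y \<tau> - x)) {0..\<tau>}))"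
  \<comment> \<open>Any choice of solutions will do: \<open>solutions_close\<close> makes the
    endpoint depend continuously on \<open>x\<close> and \<open>c\<close>.\<close>
  define y where "y = (\<lambda>x c. SOME y. sol x c y)"
  have "\<exists>y. sol x c y" for x c
    using picard_solution[OF FL t(1), of x c] t unfolding sol_def by simp
  then have "sol x c (y x c)" for x c
    unfolding y_def by (rule someI_ex)
  then have y: "continuous_on {0..t} (y x c)" "y x c 0 = x"
    "\<And>\<tau>. \<tau> \<in> {0..t} \<Longrightarrow> ((\<lambda>s. F (y x c s) + c) has_integral (y x c \<tau> - x)) {0..\<tau>}" for x c
    unfolding sol_def by auto
  have close: "norm (y x c t - y x' c' t) \<le> 2 * (norm (x - x') + t * norm (c - c'))" for x c x' c'
    using t by (intro solutions_close[OF Flip t y(1) y(3) y(1) y(3)]) auto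
  have contY: "continuous_on UNIV (\<lambda>q. y (fst q) (snd q) t)"
  proof (rule continuous_onI)
    fix q :: "'a \<times> 'a" and e :: real assume e: "e > 0"
    show "\<exists>d>0. \<forall>q'\<in>UNIV. dist q' q < d \<longrightarrow> dist (y (fst q') (snd q') t) (y (fst q) (snd q) t) \<le> e"
    proof (intro exI[of _ "e / (2 * (1 + t))"] conjI ballI impI)
      fix q' assume q': "dist q' q < e / (2 * (1 + t))"
      have "dist (y (fst q') (snd q') t) (y (fst q) (snd q) t)
          \<le> 2 * (dist (fst q') (fst q) + t * dist (snd q') (snd q))"
        using close by (simp add: dist_norm)
      also have "\<dots> \<le> 2 * (dist q' q + t * dist q' q)"
        using t by (intro mult_left_mono add_mono dist_fst_le dist_snd_le) auto
      also have "\<dots> = dist q' q * (2 * (1 + t))" by (simp add: algebra_simps)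
      also have "\<dots> \<le> e" using q' t by (simp add: less_divide_eq)
      finally show "dist (y (fst q') (snd q') t) (y (fst q) (snd q) t) \<le> e" .
    qed (use e t in auto)
  qed
  show ?thesis
  proof
    show "continuous_on UNIV (\<lambda>q. y (fst q) (snd q) t)" by fact
    fix x a1 a2 d \<delta>
    define c where "c = a1 *\<^sub>R g1 + a2 *\<^sub>R g2"
    assume \<delta>: "(\<delta>::real) \<ge> 0" and x: "norm x + 2 * t * (norm d + \<delta>) \<le> \<rho>"
      and near: "\<And>z. norm (z - x) \<le> 2 * t * (norm d + \<delta>) \<Longrightarrow> norm (f z + (a1 *\<^sub>R g1 + a2 *\<^sub>R g2) - d) \<le> \<delta>"
    have zin: "norm z \<le> \<rho>" if "norm (z - x) \<le> 2 * t * (norm d + \<delta>)" for z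
      using that x norm_triangle_sub[of z x] by linarith
    have nearF: "norm (F z + c - d) \<le> \<delta>" if "norm (z - x) \<le> 2 * t * (norm d + \<delta>)" for z
      using near[OF that] Ff[OF zin[OF that]] by (simp add: c_def)
    note sn = solution_near_start[OF Flip t y(1)[of x c] y(3)[of _ x c] nearF \<delta>]
    have "controlled_trajectory UNIV f g1 g2 t (\<lambda>_. a1) (\<lambda>_. a2) (y x c)"
      unfolding controlled_trajectory_def
    proof (intro conjI ballI)
      fix \<tau> assume \<tau>: "\<tau> \<in> {0..t}"
      have "F (y x c s) + c = f (y x c s) + a1 *\<^sub>R g1 + a2 *\<^sub>R g2" if "s \<in> {0..\<tau>}" for s
        using Ff[OF zin[OF sn(1)[where \<tau> = s]]] that \<tau> by (auto simp: c_def add.assoc)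
      from has_integral_eq[OF this y(3)[OF \<tau>]]
      show "((\<lambda>s. f (y x c s) + a1 *\<^sub>R g1 + a2 *\<^sub>R g2) has_integral y x c \<tau> - y x c 0) {0..\<tau>}"
        by (simp add: y(2))
    qed (use y in auto)
    then have "steers f g1 g2 x (y x c t)"
      unfolding steers_def using t y(2) by (intro exI[of _ t] conjI exI[of _ "\<lambda>_. a1"] exI[of _ "\<lambda>_. a2"] exI[of _ "y x c"]) auto
    with sn(2) show "steers f g1 g2 x (y x (a1 *\<^sub>R g1 + a2 *\<^sub>R g2) t) \<and>
      norm (y x (a1 *\<^sub>R g1 + a2 *\<^sub>R g2) t - (x + t *\<^sub>R d)) \<le> t * \<delta>"
      by (simp add: c_def)
  qed
qed

text \<open>The parameter \<open>p\<close> lives in the state space because it later becomes the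
  unknown of a fixed point equation. Joint continuity of \<open>E\<close> lets motions be
  composed.\<close>

definition approx_translation ::
  "('a::euclidean_space \<Rightarrow> 'a) \<Rightarrow> 'a \<Rightarrow> 'a \<Rightarrow> ('a \<Rightarrow> 'a) \<Rightarrow> bool" where
  "approx_translation f g1 g2 h \<longleftrightarrow> (\<forall>R. \<forall>\<epsilon>>0. \<exists>E. continuous_on (cball 0 R \<times> cball 0 R) E \<and>
     (\<forall>x\<in>cball 0 R. \<forall>p\<in>cball 0 R. steers f g1 g2 x (E (x, p)) \<and> norm (E (x, p) - (x + h p)) \<le> \<epsilon>))"

text \<open>The coefficients are arbitrary continuous functions of \<open>p\<close>, so that
  finitely many jumps combine into a translation by a vector depending on \<open>p\<close>.\<close>

definition jump_directions :: "('a::euclidean_space \<Rightarrow> 'a) \<Rightarrow> 'a \<Rightarrow> 'a \<Rightarrow> 'a set" where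
  "jump_directions f g1 g2 =
     {v. \<forall>\<phi>. continuous_on UNIV \<phi> \<longrightarrow> approx_translation f g1 g2 (\<lambda>p. \<phi> p *\<^sub>R v)}"

lemma approx_translationE:
  assumes "approx_translation f g1 g2 h" "\<epsilon> > 0"
  obtains E where "continuous_on (cball 0 R \<times> cball 0 R) E"
    "\<And>x p. norm x \<le> R \<Longrightarrow> norm p \<le> R \<Longrightarrow> steers f g1 g2 x (E (x, p))"
    "\<And>x p. norm x \<le> R \<Longrightarrow> norm p \<le> R \<Longrightarrow> norm (E (x, p) - (x + h p)) \<le> \<epsilon>"
  using assms unfolding approx_translation_def by (metis mem_cball_0)

lemma continuous_bound_cball:
  fixes h :: "'a::euclidean_space \<Rightarrow> 'b::real_normed_vector"
  assumes "continuous_on UNIV h"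
  obtains M where "M \<ge> 0" "\<And>p. norm p \<le> R \<Longrightarrow> norm (h p) \<le> M"
proof -
  have "bounded (h ` cball 0 R)"
    by (intro compact_imp_bounded compact_continuous_image continuous_on_subset[OF assms]) auto
  then obtain M where "\<And>p. norm p \<le> R \<Longrightarrow> norm (h p) \<le> M"
    unfolding bounded_iff by (metis imageI mem_cball_0)
  then have "\<And>p. norm p \<le> R \<Longrightarrow> norm (h p) \<le> max 0 M" by fastforce
  then show ?thesis using that[of "max 0 M"] by auto
qed

lemma approx_translation_zero: "approx_translation f g1 g2 (\<lambda>p. 0)"
proof -
  have "steers f g1 g2 x x" for x
    unfolding steers_def
    by (intro exI[of _ 0] conjI exI[of _ "\<lambda>_. 0"] exI[of _ "\<lambda>_. x"])
       (auto simp: controlled_trajectory_def)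
  then show ?thesis
    unfolding approx_translation_def
    by (intro allI impI exI[of _ fst]) (auto intro: continuous_intros)
qed

text \<open>Perform the first motion and then the second with the same parameter; each gets half of
  the error.\<close>

lemma approx_translation_add:
  assumes h1: "approx_translation f g1 g2 h1" "continuous_on UNIV h1"
    and h2: "approx_translation f g1 g2 h2"
  shows "approx_translation f g1 g2 (\<lambda>p. h1 p + h2 p)"
  unfolding approx_translation_def
proof (intro allI impI)
  fix R \<epsilon> :: real assume \<epsilon>: "\<epsilon> > 0"
  obtain M where M: "M \<ge> 0" "\<And>p. norm p \<le> R \<Longrightarrow> norm (h1 p) \<le> M"
    using continuous_bound_cball[OF h1(2)] by blast
  obtain E1 where E1: "continuous_on (cball 0 R \<times> cball 0 R) E1"
    "\<And>x p. norm x \<le> R \<Longrightarrow> norm p \<le> R \<Longrightarrow> steers f g1 g2 x (E1 (x, p))"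
    "\<And>x p. norm x \<le> R \<Longrightarrow> norm p \<le> R \<Longrightarrow> norm (E1 (x, p) - (x + h1 p)) \<le> \<epsilon>/2"
    using approx_translationE[OF h1(1), of "\<epsilon>/2" R] \<epsilon> by auto
  \<comment> \<open>Large enough for all endpoints of the first motion, from which the second one
    starts.\<close>
  define R2 where "R2 = R + M + \<epsilon>/2"
  obtain E2 where E2: "continuous_on (cball 0 R2 \<times> cball 0 R2) E2"
    "\<And>x p. norm x \<le> R2 \<Longrightarrow> norm p \<le> R2 \<Longrightarrow> steers f g1 g2 x (E2 (x, p))"
    "\<And>x p. norm x \<le> R2 \<Longrightarrow> norm p \<le> R2 \<Longrightarrow> norm (E2 (x, p) - (x + h2 p)) \<le> \<epsilon>/2"
    using approx_translationE[OF h2(1), of "\<epsilon>/2" R2] \<epsilon> by auto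
  have E1R: "norm (E1 (x, p)) \<le> R2" if "norm x \<le> R" "norm p \<le> R" for x p
    using E1(3)[OF that] M(2)[OF that(2)] that(1) norm_triangle_sub[of "E1 (x, p)" "x + h1 p"]
      norm_triangle_ineq[of x "h1 p"] by (simp add: R2_def)
  have R: "norm p \<le> R2" if "norm p \<le> R" for p :: 'a
    using that M(1) \<epsilon> by (simp add: R2_def)
  show "\<exists>E. continuous_on (cball 0 R \<times> cball 0 R) E \<and> (\<forall>x\<in>cball 0 R. \<forall>p\<in>cball 0 R.
    steers f g1 g2 x (E (x, p)) \<and> norm (E (x, p) - (x + (h1 p + h2 p))) \<le> \<epsilon>)"
  proof (intro exI[of _ "\<lambda>q. E2 (E1 q, snd q)"] conjI ballI)
    show "continuous_on (cball 0 R \<times> cball 0 R) (\<lambda>q. E2 (E1 q, snd q))"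
      by (rule continuous_on_compose2[OF E2(1)])
         (use E1(1) E1R R in \<open>auto intro!: continuous_intros\<close>)
    fix x p :: 'a assume "x \<in> cball 0 R" "p \<in> cball 0 R"
    then have xp: "norm x \<le> R" "norm p \<le> R" by auto
    show "steers f g1 g2 x (E2 (E1 (x, p), snd (x, p)))"
      using steers_trans[OF E1(2)[OF xp] E2(2)[OF E1R[OF xp] R[OF xp(2)]]] by simp
    have "norm ((E1 (x, p) - (x + h1 p)) + (E2 (E1 (x, p), p) - (E1 (x, p) + h2 p))) \<le> \<epsilon>/2 + \<epsilon>/2"
      by (rule norm_triangle_le[OF add_mono[OF E1(3)[OF xp] E2(3)[OF E1R[OF xp] R[OF xp(2)]]]])
    then show "norm (E2 (E1 (x, p), snd (x, p)) - (x + (h1 p + h2 p))) \<le> \<epsilon>"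
      by (simp add: algebra_simps)
  qed
qed

lemma subspace_jump_directions: "subspace (jump_directions f g1 g2)"
  unfolding subspace_def
proof (intro conjI allI ballI)
  show "0 \<in> jump_directions f g1 g2"
    by (simp add: jump_directions_def approx_translation_zero)
  show "x + y \<in> jump_directions f g1 g2"
    if "x \<in> jump_directions f g1 g2" "y \<in> jump_directions f g1 g2" for x y
    using that unfolding jump_directions_def
    by (auto simp: scaleR_add_right intro!: approx_translation_add continuous_intros)
  show "c *\<^sub>R x \<in> jump_directions f g1 g2" if "x \<in> jump_directions f g1 g2" for c x
    unfolding jump_directions_def
  proof (intro CollectI allI impI)
    fix \<phi> :: "'a \<Rightarrow> real" assume "continuous_on UNIV \<phi>"
    then have "continuous_on UNIV (\<lambda>p. \<phi> p * c)" by (intro continuous_intros)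
    then show "approx_translation f g1 g2 (\<lambda>p. \<phi> p *\<^sub>R c *\<^sub>R x)"
      using that unfolding jump_directions_def by fastforce
  qed
qed

lemma approx_translation_sum:
  assumes "finite I" "\<And>i. i \<in> I \<Longrightarrow> v i \<in> jump_directions f g1 g2"
    and "\<And>i. i \<in> I \<Longrightarrow> continuous_on UNIV (\<phi> i)"
  shows "approx_translation f g1 g2 (\<lambda>p. \<Sum>i\<in>I. \<phi> i p *\<^sub>R v i)"
  using assms
proof (induction I)
  case empty
  show ?case by (simp add: approx_translation_zero)
next
  case (insert i I)
  then show ?case
    by (auto simp: jump_directions_def intro!: approx_translation_add continuous_intros)
qed

lemma steers_swap: "steers f g1 g2 x y \<longleftrightarrow> steers f g2 g1 x y"
proof -
  have "controlled_trajectory UNIV f g1 g2 T u1 u2 z = controlled_trajectory UNIV f g2 g1 T u2 u1 z"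
    for T u1 u2 z
    by (simp add: controlled_trajectory_def add_ac)
  then show ?thesis unfolding steers_def by blast
qed

lemma jump_directions_swap: "jump_directions f g1 g2 = jump_directions f g2 g1"
  by (simp add: jump_directions_def approx_translation_def steers_swap[of f g1])

text \<open>The constant control \<open>\<phi> p / t\<close> held for time \<open>t\<close>
  contributes exactly \<open>\<phi> p *\<^sub>R g1\<close>, while the drift, bounded by
  \<open>D\<close> on a fixed ball, contributes at most \<open>t * D\<close>.\<close>

lemma control_in_jump_directions:
  fixes f :: "'a::euclidean_space \<Rightarrow> 'a"
  assumes lip: "\<And>\<rho>. \<exists>L. L-lipschitz_on (cball 0 \<rho>) f"
  shows "g1 \<in> jump_directions f g1 g2"
  unfolding jump_directions_def approx_translation_def
proof (intro CollectI allI impI)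
  fix \<phi> :: "'a \<Rightarrow> real" and R \<epsilon> :: real
  assume \<phi>: "continuous_on UNIV \<phi>" and \<epsilon>: "\<epsilon> > 0"
  obtain M where M: "M \<ge> 0" "\<And>p. norm p \<le> R \<Longrightarrow> \<bar>\<phi> p\<bar> \<le> M"
    using continuous_bound_cball[OF \<phi>, of R] by (auto simp: real_norm_def)
  \<comment> \<open>Room for the start and for twice the control displacement plus the bound
    \<open>1\<close> on \<open>t * D\<close>, as \<open>local_flow\<close> requires.\<close>
  define \<rho> where "\<rho> = max 0 R + 2 * (M * norm g1 + 1)"
  have \<rho>: "\<rho> \<ge> 0" using M by (auto simp: \<rho>_def)
  obtain L where L: "L-lipschitz_on (cball 0 \<rho>) f" using lip by blast
  have L0: "L \<ge> 0" using L lipschitz_on_nonneg by blast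
  define D where "D = norm (f 0) + L * \<rho>"
  have D0: "D \<ge> 0" using L0 \<rho> by (simp add: D_def)
  have fD: "norm (f z) \<le> D" if "norm z \<le> \<rho>" for z
  proof -
    have "norm (f z - f 0) \<le> L * norm z"
      using lipschitz_onD[OF L, of z 0] that \<rho> by (simp add: dist_norm)
    also have "\<dots> \<le> L * \<rho>" using that L0 by (intro mult_left_mono) auto
    finally show ?thesis using norm_triangle_sub[of "f z" "f 0"] by (simp add: D_def)
  qed
  \<comment> \<open>The first bound gives \<open>t * L \<le> 1/2\<close>; the second makes the drift
    contribution at most \<open>1\<close> and at most \<open>\<epsilon>\<close>.\<close>
  define t where "t = min (1 / (2 * (L + 1))) (min 1 \<epsilon> / (D + 1))"
  have t: "t > 0" using L0 D0 \<epsilon> by (simp add: t_def)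
  have "t * L \<le> 1 / (2 * (L + 1)) * L" using L0 by (intro mult_right_mono) (auto simp: t_def)
  also have "\<dots> \<le> 1/2" using L0 by (simp add: field_simps)
  finally have tL: "t * L \<le> 1/2" .
  have "t * D \<le> min 1 \<epsilon> / (D + 1) * D" using D0 by (intro mult_right_mono) (auto simp: t_def)
  also have "\<dots> = min 1 \<epsilon> * (D / (D + 1))" by simp
  also have "\<dots> \<le> min 1 \<epsilon> * 1"
    using D0 \<epsilon> by (intro mult_left_mono) auto
  finally have tD: "t * D \<le> 1" "t * D \<le> \<epsilon>" by auto
  obtain Y where Y: "continuous_on UNIV (\<lambda>q. Y (fst q) (snd q))"
    "\<And>x a1 a2 d \<delta>. \<delta> \<ge> 0 \<Longrightarrow> norm x + 2 * t * (norm d + \<delta>) \<le> \<rho> \<Longrightarrow>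
      (\<And>z. norm (z - x) \<le> 2 * t * (norm d + \<delta>) \<Longrightarrow> norm (f z + (a1 *\<^sub>R g1 + a2 *\<^sub>R g2) - d) \<le> \<delta>) \<Longrightarrow>
      steers f g1 g2 x (Y x (a1 *\<^sub>R g1 + a2 *\<^sub>R g2)) \<and>
      norm (Y x (a1 *\<^sub>R g1 + a2 *\<^sub>R g2) - (x + t *\<^sub>R d)) \<le> t * \<delta>"
    using local_flow[OF L \<rho> less_imp_le[OF t] tL, of g1 g2] by blast
  show "\<exists>E. continuous_on (cball 0 R \<times> cball 0 R) E \<and> (\<forall>x\<in>cball 0 R. \<forall>p\<in>cball 0 R.
    steers f g1 g2 x (E (x, p)) \<and> norm (E (x, p) - (x + \<phi> p *\<^sub>R g1)) \<le> \<epsilon>)"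
  proof (intro exI[of _ "\<lambda>q. Y (fst q) ((\<phi> (snd q) / t) *\<^sub>R g1 + 0 *\<^sub>R g2)"] conjI)
    have c\<phi>: "continuous_on S (\<lambda>q. \<phi> (snd q))" for S :: "('a \<times> 'a) set"
      by (rule continuous_on_compose2[OF \<phi>]) (auto intro: continuous_intros)
    show "continuous_on (cball 0 R \<times> cball 0 R) (\<lambda>q. Y (fst q) ((\<phi> (snd q) / t) *\<^sub>R g1 + 0 *\<^sub>R g2))"
      using t by (intro continuous_on_compose2[OF Y(1), of _ "\<lambda>q. (fst q, (\<phi> (snd q) / t) *\<^sub>R g1 + 0 *\<^sub>R g2)",
        simplified fst_conv snd_conv] continuous_intros c\<phi>) auto
    show "\<forall>x\<in>cball 0 R. \<forall>p\<in>cball 0 R.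
      steers f g1 g2 x (Y (fst (x, p)) ((\<phi> (snd (x, p)) / t) *\<^sub>R g1 + 0 *\<^sub>R g2)) \<and>
      norm (Y (fst (x, p)) ((\<phi> (snd (x, p)) / t) *\<^sub>R g1 + 0 *\<^sub>R g2) - (x + \<phi> p *\<^sub>R g1)) \<le> \<epsilon>"
    proof (intro ballI)
      fix x p :: 'a assume "x \<in> cball 0 R" "p \<in> cball 0 R"
      then have xp: "norm x \<le> R" "norm p \<le> R" by auto
      let ?d = "(\<phi> p / t) *\<^sub>R g1"
      have "2 * t * (norm ?d + D) = 2 * (\<bar>\<phi> p\<bar> * norm g1 + t * D)"
        using t by (simp add: field_simps)
      also have "\<dots> \<le> 2 * (M * norm g1 + 1)"
        using M(2)[OF xp(2)] tD by (intro mult_left_mono add_mono mult_right_mono) auto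
      finally have b: "norm x + 2 * t * (norm ?d + D) \<le> \<rho>" using xp by (simp add: \<rho>_def)
      have "norm (f z + (?d + 0 *\<^sub>R g2) - ?d) \<le> D" if "norm (z - x) \<le> 2 * t * (norm ?d + D)" for z
        using fD[of z] that b norm_triangle_sub[of z x] by simp
      from Y(2)[OF D0 b this] tD t
      show "steers f g1 g2 x (Y (fst (x, p)) ((\<phi> (snd (x, p)) / t) *\<^sub>R g1 + 0 *\<^sub>R g2)) \<and>
        norm (Y (fst (x, p)) ((\<phi> (snd (x, p)) / t) *\<^sub>R g1 + 0 *\<^sub>R g2) - (x + \<phi> p *\<^sub>R g1)) \<le> \<epsilon>"
        by auto
    qed
  qed
qed

section \<open>Quadratic drifts\<close>

lemma bilinear_quadratic_lipschitz:
  fixes b :: "'a::euclidean_space \<Rightarrow> 'a \<Rightarrow> 'a"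
  assumes b: "bilinear b" and bK: "\<And>x y. norm (b x y) \<le> K * norm x * norm y"
    and l: "linear l" and lK: "\<And>x. norm (l x) \<le> K * norm x" and K: "K \<ge> 0" and \<rho>: "\<rho> \<ge> 0"
  shows "(2 * K * \<rho> + K)-lipschitz_on (cball 0 \<rho>) (\<lambda>x. b x x + l x)"
proof (rule lipschitz_onI)
  fix x y :: 'a assume "x \<in> cball 0 \<rho>" "y \<in> cball 0 \<rho>"
  then have xy: "norm x \<le> \<rho>" "norm y \<le> \<rho>" by auto
  have "(b x x + l x) - (b y y + l y) = b x (x - y) + b (x - y) y + l (x - y)"
    using b l by (simp add: bilinear_lsub bilinear_rsub linear_diff)
  also have "norm \<dots> \<le> K * norm x * norm (x - y) + K * norm (x - y) * norm y + K * norm (x - y)"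
    by (intro norm_triangle_le add_mono bK lK)
  also have "\<dots> \<le> K * \<rho> * norm (x - y) + K * norm (x - y) * \<rho> + K * norm (x - y)"
    using xy K by (intro add_mono mult_right_mono mult_left_mono) auto
  finally show "dist (b x x + l x) (b y y + l y) \<le> (2 * K * \<rho> + K) * dist x y"
    by (simp add: dist_norm algebra_simps)
qed (use K \<rho> in auto)

locale quadratic_control =
  fixes b :: "'a::euclidean_space \<Rightarrow> 'a \<Rightarrow> 'a" and l :: "'a \<Rightarrow> 'a" and g1 g2 :: 'a
  assumes b: "bilinear b" and l: "linear l"
begin

abbreviation f where "f \<equiv> (\<lambda>x. b x x + l x)"
abbreviation J where "J \<equiv> jump_directions f g1 g2"

lemma coefficient_bounds:
  obtains K where "K > 0" "\<And>x y. norm (b x y) \<le> K * norm x * norm y" "\<And>x. norm (l x) \<le> K * norm x"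
proof -
  obtain A where A: "A > 0" "\<And>x y. norm (b x y) \<le> A * norm x * norm y"
    using bilinear_bounded_pos[OF b] by blast
  obtain B where B: "B > 0" "\<And>x. norm (l x) \<le> B * norm x"
    using linear_bounded_pos[OF l] by blast
  show ?thesis
  proof
    show "max A B > 0" using A by simp
    show "norm (b x y) \<le> max A B * norm x * norm y" for x y
      by (rule order_trans[OF A(2)]) (intro mult_right_mono, auto)
    show "norm (l x) \<le> max A B * norm x" for x
      by (rule order_trans[OF B(2)]) (intro mult_right_mono, auto)
  qed
qed

lemma controls_in_J: "g1 \<in> J" "g2 \<in> J"
proof -
  obtain K where K: "K > 0" "\<And>x y. norm (b x y) \<le> K * norm x * norm y" "\<And>x. norm (l x) \<le> K * norm x"
    using coefficient_bounds by blast
  have lip: "\<exists>L. L-lipschitz_on (cball 0 \<rho>) f" for \<rho>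
  proof (cases "\<rho> \<ge> 0")
    case True
    then show ?thesis using bilinear_quadratic_lipschitz[OF b K(2) l K(3)] K(1) by fastforce
  next
    case False
    then show ?thesis by (auto simp: lipschitz_on_def)
  qed
  show "g1 \<in> J" "g2 \<in> J"
    using control_in_jump_directions[of f, OF lip] jump_directions_swap[of f g1 g2] by auto
qed

text \<open>Jump to \<open>x + r\<^sup>2 g + \<phi> r w\<close>, drift for time \<open>1/r\<^sup>3\<close>, and jump back: since \<open>b g g = 0\<close>, the
  dominating term of the drift is \<open>r\<^sup>3 \<phi> (b g w + b w g)\<close>, and all others contribute \<open>O(1/r)\<close>.\<close>

lemma J_extend:
  assumes g: "g \<in> J" "b g g = 0" and w: "w \<in> J"
  shows "b g w + b w g \<in> J"
  unfolding jump_directions_def approx_translation_def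
proof (intro CollectI allI impI)
  fix \<phi> :: "'a \<Rightarrow> real" and R \<epsilon> :: real
  assume \<phi>: "continuous_on UNIV \<phi>" and \<epsilon>: "\<epsilon> > 0"
  define v where "v = b g w + b w g"
  obtain M where M: "M \<ge> 0" "\<And>p. norm p \<le> R \<Longrightarrow> \<bar>\<phi> p\<bar> \<le> M"
    using continuous_bound_cball[OF \<phi>, of R] by (auto simp: real_norm_def)
  obtain K where K: "K > 0" "\<And>x y. norm (b x y) \<le> K * norm x * norm y" "\<And>x. norm (l x) \<le> K * norm x"
    using coefficient_bounds by blast
  \<comment> \<open>Bounds the distance to \<open>h p\<close> during the drift: \<open>R\<close> for
    the start, \<open>1\<close> for the error of the first jump, the rest for the motion while
    drifting. Next, \<open>H * r\<^sup>2\<close> will bound \<open>h p\<close>, and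
    \<open>D * r\<^sup>2\<close> all terms of the drift other than the one along
    \<open>v\<close>.\<close>
  define \<rho>0 where "\<rho>0 = max 0 R + 1 + 2 * (M * norm v + 1)"
  define H where "H = norm g + M * norm w"
  define D where "D = K * \<rho>0\<^sup>2 + 2 * K * \<rho>0 * H + K * (M * norm w)\<^sup>2 + K * \<rho>0 + K * H"
  \<comment> \<open>The four lower bounds give, in order, \<open>r \<le> r\<^sup>2\<close>, the step
    condition of \<open>local_flow\<close>, \<open>t * \<delta> \<le> 1\<close> and
    \<open>t * \<delta> \<le> \<epsilon>/3\<close>.\<close>
  define r where "r = max (max 1 (2 * (2 * K * \<rho>0 + 2 * K * H + K))) (max D (3 * D / \<epsilon>))"
  have \<rho>0: "\<rho>0 \<ge> 0" and H: "H \<ge> 0" using M by (auto simp: \<rho>0_def H_def)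
  have D: "D \<ge> 0" unfolding D_def using K \<rho>0 H M by (intro add_nonneg_nonneg mult_nonneg_nonneg) auto
  have r: "r \<ge> 1" "2 * (2 * K * \<rho>0 + 2 * K * H + K) \<le> r" "D \<le> r" "3 * D / \<epsilon> \<le> r"
    unfolding r_def by linarith+
  have r2: "r\<^sup>2 \<ge> 1" "r \<le> r\<^sup>2" "r\<^sup>2 \<ge> 0"
    using r(1) by (auto simp: one_le_power self_le_power)
  define t where "t = 1 / r^3"
  have t: "t > 0" using r(1) by (simp add: t_def)
  have tr: "t * r^3 = 1" "t * r\<^sup>2 = 1 / r" using r(1) by (simp_all add: t_def power3_eq_cube power2_eq_square)
  define \<delta> where "\<delta> = D * r\<^sup>2"
  have \<delta>: "\<delta> \<ge> 0" using D by (simp add: \<delta>_def)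
  have t\<delta>': "t * \<delta> = D / r" using arg_cong[OF tr(2), of "(*) D"] by (simp add: \<delta>_def mult_ac)
  have t\<delta>: "t * \<delta> \<le> 1" "t * \<delta> \<le> \<epsilon>/3"
    using r \<epsilon> unfolding t\<delta>' by (simp_all add: field_simps)
  define h where "h = (\<lambda>p. r\<^sup>2 *\<^sub>R g + (\<phi> p * r) *\<^sub>R w)"
  have h_cont: "continuous_on UNIV h" unfolding h_def by (intro continuous_intros \<phi>)
  have hH: "norm (h p) \<le> H * r\<^sup>2" if "norm p \<le> R" for p
  proof -
    have "norm (h p) \<le> r\<^sup>2 * norm g + (\<bar>\<phi> p\<bar> * r) * norm w"
      unfolding h_def using r by (intro norm_triangle_le) (simp add: abs_mult)
    also have "\<dots> \<le> r\<^sup>2 * norm g + (M * r\<^sup>2) * norm w"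
      using M(1) M(2)[OF that] r r2 by (intro add_mono mult_right_mono mult_mono) auto
    finally show ?thesis by (simp add: H_def algebra_simps)
  qed
  define \<rho> where "\<rho> = \<rho>0 + H * r\<^sup>2"
  have \<rho>: "\<rho> \<ge> 0" using \<rho>0 H r2 by (simp add: \<rho>_def)
  have "t * (2 * K * \<rho> + K) \<le> t * (2 * K * (\<rho>0 * r\<^sup>2 + H * r\<^sup>2) + K * r\<^sup>2)"
    unfolding \<rho>_def using t K(1) \<rho>0 H r2 mult_left_mono[of 1 "r\<^sup>2" \<rho>0]
    by (intro mult_left_mono add_mono) auto
  also have "\<dots> = (t * r\<^sup>2) * (2 * K * \<rho>0 + 2 * K * H + K)" by (simp add: algebra_simps)
  also have "\<dots> \<le> 1/2" unfolding tr(2) using r by (simp add: field_simps)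
  finally have tL: "t * (2 * K * \<rho> + K) \<le> 1/2" .
  obtain Y where Y: "continuous_on UNIV (\<lambda>q. Y (fst q) (snd q))"
    "\<And>x a1 a2 d \<delta>. \<delta> \<ge> 0 \<Longrightarrow> norm x + 2 * t * (norm d + \<delta>) \<le> \<rho> \<Longrightarrow>
      (\<And>z. norm (z - x) \<le> 2 * t * (norm d + \<delta>) \<Longrightarrow> norm (f z + (a1 *\<^sub>R g1 + a2 *\<^sub>R g2) - d) \<le> \<delta>) \<Longrightarrow>
      steers f g1 g2 x (Y x (a1 *\<^sub>R g1 + a2 *\<^sub>R g2)) \<and>
      norm (Y x (a1 *\<^sub>R g1 + a2 *\<^sub>R g2) - (x + t *\<^sub>R d)) \<le> t * \<delta>"
    using local_flow[OF bilinear_quadratic_lipschitz[OF b K(2) l K(3) less_imp_le[OF K(1)] \<rho>] \<rho>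
        less_imp_le[OF t] tL, of g1 g2] by blast
  have drift: "norm (f (y + h p) - (r^3 * \<phi> p) *\<^sub>R v) \<le> \<delta>"
    if p: "norm p \<le> R" and y: "norm y \<le> \<rho>0" for y p
  proof -
    have "f (y + h p) = b y y + (b y (h p) + b (h p) y) + b (h p) (h p) + l y + l (h p)"
      using b l by (simp add: bilinear_ladd bilinear_radd linear_add)
    \<comment> \<open>\<open>b g g = 0\<close> removes the term of order \<open>r^4\<close>; the
      mixed terms have order \<open>r^3\<close>, and the square of the \<open>w\<close> part only
      order \<open>r\<^sup>2\<close>.\<close>
    moreover have "b (h p) (h p) = (r^3 * \<phi> p) *\<^sub>R v + (\<phi> p * r)\<^sup>2 *\<^sub>R b w w"
      unfolding h_def v_def using b g(2)
      by (simp add: bilinear_ladd bilinear_radd bilinear_lmul bilinear_rmul algebra_simps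
          power2_eq_square power3_eq_cube)
    ultimately have "norm (f (y + h p) - (r^3 * \<phi> p) *\<^sub>R v)
        = norm (b y y + (b y (h p) + b (h p) y) + (\<phi> p * r)\<^sup>2 *\<^sub>R b w w + l y + l (h p))"
      by simp
    also have "\<dots> \<le> K * norm y * norm y + (K * norm y * norm (h p) + K * norm (h p) * norm y)
        + (\<phi> p * r)\<^sup>2 * (K * norm w * norm w) + K * norm y + K * norm (h p)"
      by (intro norm_triangle_le add_mono K) (simp add: K mult_left_mono)
    also have "\<dots> \<le> K * \<rho>0 * \<rho>0 + (K * \<rho>0 * (H * r\<^sup>2) + K * (H * r\<^sup>2) * \<rho>0)
        + (M * r)\<^sup>2 * (K * norm w * norm w) + K * \<rho>0 + K * (H * r\<^sup>2)"
    proof -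
      have "(\<phi> p * r)\<^sup>2 \<le> (M * r)\<^sup>2"
        using M(2)[OF p] M(1) r by (intro power2_le_iff_abs_le[THEN iffD2]) (auto simp: abs_mult)
      then show ?thesis
        using K(1) y hH[OF p] \<rho>0 H r2 by (intro add_mono mult_mono) auto
    qed
    also have "\<dots> \<le> K * \<rho>0 * \<rho>0 * r\<^sup>2 + (K * \<rho>0 * (H * r\<^sup>2) + K * (H * r\<^sup>2) * \<rho>0)
        + (M * r)\<^sup>2 * (K * norm w * norm w) + K * \<rho>0 * r\<^sup>2 + K * (H * r\<^sup>2)"
      using K(1) \<rho>0 r2 mult_left_mono[of 1 "r\<^sup>2" "K * \<rho>0 * \<rho>0"] mult_left_mono[of 1 "r\<^sup>2" "K * \<rho>0"]
      by (intro add_mono) auto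
    also have "\<dots> = \<delta>" by (simp add: \<delta>_def D_def algebra_simps power2_eq_square)
    finally show ?thesis .
  qed
  have h_app: "approx_translation f g1 g2 h" "approx_translation f g1 g2 (\<lambda>p. - h p)"
  proof -
    have c: "approx_translation f g1 g2 (\<lambda>p. a *\<^sub>R g + (\<phi> p * a') *\<^sub>R w)" for a a'
      using g(1) w \<phi> by (intro approx_translation_add)
        (auto simp: jump_directions_def intro!: continuous_intros)
    show "approx_translation f g1 g2 h" using c[of "r\<^sup>2" r] by (simp add: h_def)
    show "approx_translation f g1 g2 (\<lambda>p. - h p)" using c[of "- r\<^sup>2" "- r"] by (simp add: h_def)
  qed
  \<comment> \<open>Each of the two jumps gets a third of \<open>\<epsilon>\<close>, the drift the
    remaining third.\<close>
  define \<eta> where "\<eta> = min 1 (\<epsilon>/3)"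
  have \<eta>: "\<eta> > 0" "\<eta> \<le> 1" "\<eta> \<le> \<epsilon>/3" using \<epsilon> by (auto simp: \<eta>_def)
  obtain E1 where E1: "continuous_on (cball 0 R \<times> cball 0 R) E1"
    "\<And>x p. norm x \<le> R \<Longrightarrow> norm p \<le> R \<Longrightarrow> steers f g1 g2 x (E1 (x, p))"
    "\<And>x p. norm x \<le> R \<Longrightarrow> norm p \<le> R \<Longrightarrow> norm (E1 (x, p) - (x + h p)) \<le> \<eta>"
    using approx_translationE[OF h_app(1) \<eta>(1), of R] by blast
  \<comment> \<open>The drift runs with both controls zero, hence the second argument
    \<open>0\<close> of \<open>Y\<close>.\<close>
  have E2: "steers f g1 g2 (E1 (x, p)) (Y (E1 (x, p)) 0)"
    "norm (Y (E1 (x, p)) 0 - (E1 (x, p) + \<phi> p *\<^sub>R v)) \<le> t * \<delta>"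
    if xp: "norm x \<le> R" "norm p \<le> R" for x p
  proof -
    let ?d = "(r^3 * \<phi> p) *\<^sub>R v" and ?x = "E1 (x, p)"
    have "2 * t * (norm ?d + \<delta>) = 2 * ((t * r^3) * \<bar>\<phi> p\<bar> * norm v + t * \<delta>)"
      using r by (simp add: abs_mult algebra_simps)
    also have "\<dots> \<le> 2 * (M * norm v + 1)"
      unfolding tr using M(2)[OF xp(2)] t\<delta> by (intro mult_left_mono add_mono mult_right_mono) auto
    finally have d: "2 * t * (norm ?d + \<delta>) \<le> 2 * (M * norm v + 1)" .
    have xh: "norm (?x - h p) \<le> R + 1"
      using norm_triangle_ineq[of "?x - (x + h p)" x] E1(3)[OF xp] xp(1) \<eta> by simp
    have 1: "norm ?x + 2 * t * (norm ?d + \<delta>) \<le> \<rho>"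
      using norm_triangle_sub[of ?x "h p"] xh d hH[OF xp(2)] by (simp add: \<rho>_def \<rho>0_def)
    have 2: "norm (f z + (0 *\<^sub>R g1 + 0 *\<^sub>R g2) - ?d) \<le> \<delta>"
      if "norm (z - ?x) \<le> 2 * t * (norm ?d + \<delta>)" for z
    proof -
      have "norm (z - h p) \<le> \<rho>0"
        using norm_triangle_ineq[of "z - ?x" "?x - h p"] that d xh by (simp add: \<rho>0_def)
      from drift[OF xp(2) this] show ?thesis by simp
    qed
    have "t *\<^sub>R ?d = \<phi> p *\<^sub>R v" using tr(1) by (simp flip: mult.assoc)
    then show "steers f g1 g2 ?x (Y ?x 0)" "norm (Y ?x 0 - (?x + \<phi> p *\<^sub>R v)) \<le> t * \<delta>"
      using Y(2)[OF \<delta> 1 2] by (auto simp del: scaleR_scaleR)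
  qed
  \<comment> \<open>Bounds the state before the return jump; the \<open>2\<close> covers the errors
    of the first jump and of the drift.\<close>
  define R2 where "R2 = R + H * r\<^sup>2 + M * norm v + 2"
  have YR: "norm (Y (E1 (x, p)) 0) \<le> R2" if xp: "norm x \<le> R" "norm p \<le> R" for x p
  proof -
    have "norm (\<phi> p *\<^sub>R v) \<le> M * norm v" using M(2)[OF xp(2)] by (simp add: mult_right_mono)
    moreover have "Y (E1 (x, p)) 0 = (Y (E1 (x, p)) 0 - (E1 (x, p) + \<phi> p *\<^sub>R v)) + (E1 (x, p) - (x + h p))
        + x + h p + \<phi> p *\<^sub>R v" by simp
    then have "norm (Y (E1 (x, p)) 0) \<le> norm (Y (E1 (x, p)) 0 - (E1 (x, p) + \<phi> p *\<^sub>R v))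
        + norm (E1 (x, p) - (x + h p)) + norm x + norm (h p) + norm (\<phi> p *\<^sub>R v)"
      by (metis (no_types, lifting) norm_triangle_le add_mono order_refl)
    ultimately show ?thesis
      using E1(3)[OF xp] E2(2)[OF xp] t\<delta>(1) \<eta>(2) xp(1) hH[OF xp(2)] by (simp add: R2_def)
  qed
  have pR: "norm p \<le> R2" if "norm p \<le> R" for p :: 'a
    using that mult_nonneg_nonneg[OF H r2(3)] mult_nonneg_nonneg[OF M(1) norm_ge_zero[of v]]
    unfolding R2_def by linarith
  obtain E3 where E3: "continuous_on (cball 0 R2 \<times> cball 0 R2) E3"
    "\<And>x p. norm x \<le> R2 \<Longrightarrow> norm p \<le> R2 \<Longrightarrow> steers f g1 g2 x (E3 (x, p))"
    "\<And>x p. norm x \<le> R2 \<Longrightarrow> norm p \<le> R2 \<Longrightarrow> norm (E3 (x, p) - (x + - h p)) \<le> \<eta>"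
    using approx_translationE[OF h_app(2) \<eta>(1), of R2] by blast
  show "\<exists>E. continuous_on (cball 0 R \<times> cball 0 R) E \<and> (\<forall>x\<in>cball 0 R. \<forall>p\<in>cball 0 R.
    steers f g1 g2 x (E (x, p)) \<and> norm (E (x, p) - (x + \<phi> p *\<^sub>R (b g w + b w g))) \<le> \<epsilon>)"
  proof (intro exI[of _ "\<lambda>q. E3 (Y (E1 q) 0, snd q)"] conjI ballI)
    have "continuous_on (cball 0 R \<times> cball 0 R) (\<lambda>q. Y (E1 q) 0)"
      using continuous_on_compose2[OF Y(1) continuous_on_Pair[OF E1(1) continuous_on_const[of _ 0]]] by simp
    then show "continuous_on (cball 0 R \<times> cball 0 R) (\<lambda>q. E3 (Y (E1 q) 0, snd q))"
      by (intro continuous_on_compose2[OF E3(1)] continuous_intros) (use YR pR in auto)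
    fix x p :: 'a assume "x \<in> cball 0 R" "p \<in> cball 0 R"
    then have xp: "norm x \<le> R" "norm p \<le> R" by auto
    let ?e1 = "E1 (x, p)" let ?e2 = "Y ?e1 0" let ?e3 = "E3 (?e2, p)"
    have "steers f g1 g2 x ?e3"
      by (rule steers_trans[OF steers_trans[OF E1(2)[OF xp] E2(1)[OF xp]] E3(2)[OF YR[OF xp] pR[OF xp(2)]]])
    then show "steers f g1 g2 x (E3 (Y (E1 (x, p)) 0, snd (x, p)))" by simp
    have "norm ((?e1 - (x + h p)) + (?e2 - (?e1 + \<phi> p *\<^sub>R v)) + (?e3 - (?e2 + - h p))) \<le> \<eta> + t * \<delta> + \<eta>"
      by (intro norm_triangle_le add_mono E1(3) E2(2) E3(3) xp YR pR)
    also have "\<dots> \<le> \<epsilon>" using \<eta> t\<delta> by linarith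
    finally show "norm (E3 (Y (E1 (x, p)) 0, snd (x, p)) - (x + \<phi> p *\<^sub>R (b g w + b w g))) \<le> \<epsilon>"
      by (simp add: v_def algebra_simps)
  qed
qed

section \<open>Confinement to a subspace and exact steering\<close>

text \<open>The velocity always lies in \<open>X\<close>, so the displacement paired with a vector
  orthogonal to \<open>X\<close> is an integral of zero; the double orthogonal complement of
  \<open>X\<close> is \<open>X\<close>.\<close>

lemma trajectory_in_subspace:
  assumes X: "subspace X" and b_in: "\<And>x y. b x y \<in> X" and l_in: "\<And>x. l x \<in> X"
    and g_in: "g1 \<in> X" "g2 \<in> X"
    and z: "controlled_trajectory UNIV f g1 g2 T u1 u2 z" "z 0 \<in> X" and \<tau>: "\<tau> \<in> {0..T}"
  shows "z \<tau> \<in> X"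
proof -
  have "z \<tau> - z 0 \<in> X"
  proof -
    have "y \<bullet> (z \<tau> - z 0) = 0" if y: "y \<in> orthogonal_comp X" for y
    proof -
      have "((\<lambda>s. f (z s) + u1 s *\<^sub>R g1 + u2 s *\<^sub>R g2) has_integral (z \<tau> - z 0)) {0..\<tau>}"
        using z(1) \<tau> by (auto simp: controlled_trajectory_def)
      then have "((\<lambda>s. y \<bullet> (f (z s) + u1 s *\<^sub>R g1 + u2 s *\<^sub>R g2)) has_integral y \<bullet> (z \<tau> - z 0)) {0..\<tau>}"
        using has_integral_linear[OF _ bounded_linear_inner_right[of y]] by (simp add: o_def)
      moreover have "f (z s) + u1 s *\<^sub>R g1 + u2 s *\<^sub>R g2 \<in> X" for s
        using X b_in l_in g_in by (intro subspace_add subspace_scale) auto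
      then have "y \<bullet> (f (z s) + u1 s *\<^sub>R g1 + u2 s *\<^sub>R g2) = 0" for s
        using y by (auto simp: orthogonal_comp_def orthogonal_def inner_commute)
      ultimately show ?thesis using has_integral_is_0_cbox has_integral_unique
        by (metis (no_types, lifting) has_integral_0_eq has_integral_cong)
    qed
    then have "z \<tau> - z 0 \<in> orthogonal_comp (orthogonal_comp X)"
      by (simp add: orthogonal_comp_def orthogonal_def)
    then show ?thesis using orthogonal_comp_self[OF X] by simp
  qed
  then show ?thesis using z(2) X subspace_add by fastforce
qed

text \<open>A fixed point of \<open>p \<mapsto> p - E (a, p) + c\<close> satisfies
  \<open>E (a, p) = c\<close>. For \<open>p\<close> in \<open>X\<close> this map stays within
  distance \<open>1\<close> of the constant \<open>c - a\<close>, so accuracy \<open>1\<close>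
  already gives a self-map of a large ball in \<open>X\<close>.\<close>

theorem globally_controllable_if_jump_directions:
  assumes X: "subspace X" and b_in: "\<And>x y. b x y \<in> X" and l_in: "\<And>x. l x \<in> X"
    and g_in: "g1 \<in> X" "g2 \<in> X" and XJ: "X \<subseteq> J"
  shows "globally_controllable X f g1 g2"
  unfolding globally_controllable_def
proof (intro ballI)
  fix a c assume a: "a \<in> X" and c: "c \<in> X"
  obtain B where B: "B \<subseteq> X" "pairwise orthogonal B" "\<And>x. x \<in> B \<Longrightarrow> norm x = 1"
    "independent B" "card B = dim X" "span B = X"
    using orthonormal_basis_subspace[OF X] by metis
  have fB: "finite B" using B(4) independent_imp_finite by blast
  \<comment> \<open>The orthogonal projection onto \<open>X\<close>, written with continuous
    coefficients along jump directions; for \<open>p\<close> in \<open>X\<close> the jump is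
    \<open>p\<close> itself.\<close>
  define h where "h = (\<lambda>p::'a. \<Sum>e\<in>B. (p \<bullet> e) *\<^sub>R e)"
  have hX: "h p = p" if "p \<in> X" for p
    unfolding h_def using orthonormal_basis_expand[OF B(2,3) _ fB] B(6) that by auto
  have "approx_translation f g1 g2 h"
    unfolding h_def using B(1) XJ by (intro approx_translation_sum fB continuous_intros) auto
  \<comment> \<open>The last two summands bound the values of the self-map; \<open>norm a\<close>
    puts the start into the domain of \<open>E\<close>.\<close>
  define R where "R = norm a + norm (c - a) + 1"
  obtain E where E: "continuous_on (cball 0 R \<times> cball 0 R) E"
    "\<And>x p. norm x \<le> R \<Longrightarrow> norm p \<le> R \<Longrightarrow> steers f g1 g2 x (E (x, p))"
    "\<And>x p. norm x \<le> R \<Longrightarrow> norm p \<le> R \<Longrightarrow> norm (E (x, p) - (x + h p)) \<le> 1"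
    using approx_translationE[OF \<open>approx_translation f g1 g2 h\<close> zero_less_one, of R] by blast
  have aR: "norm a \<le> R" by (simp add: R_def)
  have EX: "E (a, p) \<in> X" if p: "norm p \<le> R" for p
  proof -
    obtain T u1 u2 z where "T \<ge> 0" "controlled_trajectory UNIV f g1 g2 T u1 u2 z" "z 0 = a" "z T = E (a, p)"
      using E(2)[OF aR p] unfolding steers_def by blast
    then show ?thesis using trajectory_in_subspace[OF X b_in l_in g_in, of T u1 u2 z T] a by auto
  qed
  obtain p where p: "p \<in> cball 0 R \<inter> X" "p - E (a, p) + c = p"
  proof (rule brouwer[of "cball 0 R \<inter> X" "\<lambda>p. p - E (a, p) + c"])
    show "compact (cball 0 R \<inter> X)" using X closed_subspace by (intro compact_Int_closed) auto
    show "convex (cball 0 R \<inter> X)" using X subspace_imp_convex by (intro convex_Int) auto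
    show "cball 0 R \<inter> X \<noteq> {}" using aR a by auto
    show "continuous_on (cball 0 R \<inter> X) (\<lambda>p. p - E (a, p) + c)"
      using aR by (intro continuous_intros continuous_on_compose2[OF E(1)]) auto
    show "(\<lambda>p. p - E (a, p) + c) \<in> cball 0 R \<inter> X \<rightarrow> cball 0 R \<inter> X"
    proof
      fix p assume p: "p \<in> cball 0 R \<inter> X"
      then have pR: "norm p \<le> R" by auto
      have "norm (- (E (a, p) - (a + h p)) + (c - a)) \<le> 1 + norm (c - a)"
        by (intro norm_triangle_le add_mono order_refl) (use E(3)[OF aR pR] in \<open>simp add: norm_minus_commute\<close>)
      then have "norm (p - E (a, p) + c) \<le> R"
        using hX[of p] p norm_ge_zero[of a] unfolding R_def by (simp add: algebra_simps del: norm_ge_zero)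
      moreover have "p - E (a, p) + c \<in> X"
        using p c EX[OF pR] X by (auto intro!: subspace_add subspace_diff)
      ultimately show "p - E (a, p) + c \<in> cball 0 R \<inter> X" by simp
    qed
  qed
  have "E (a, p) = c" using p(2) by (metis add_diff_cancel_left' add_diff_eq cancel_ab_semigroup_add_class.diff_right_commute eq_iff_diff_eq_0)
  then have "steers f g1 g2 a c" using E(2)[OF aR, of p] p(1) by auto
  then obtain T u1 u2 z where T: "T \<ge> 0" and u: "u1 \<in> borel_measurable borel" "u2 \<in> borel_measurable borel"
      "bounded (range u1)" "bounded (range u2)" and z: "controlled_trajectory UNIV f g1 g2 T u1 u2 z" "z 0 = a" "z T = c"
    unfolding steers_def by blast
  have adm: "admissible_control T u" if "u \<in> borel_measurable borel" "bounded (range u)" for u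
    unfolding admissible_control_def
  proof
    show "u \<in> borel_measurable (lebesgue_on {0..T})"
      using that(1) by (intro measurable_restrict_space1 measurable_completion) simp
    show "bounded (u ` {0..T})" by (rule bounded_subset[OF that(2)]) auto
  qed
  have "controlled_trajectory X f g1 g2 T u1 u2 z"
    using z(1) trajectory_in_subspace[OF X b_in l_in g_in z(1)] z(2) a
    by (auto simp: controlled_trajectory_def)
  then show "\<exists>T\<ge>0. \<exists>u1 u2 x. admissible_control T u1 \<and> admissible_control T u2 \<and>
      controlled_trajectory X f g1 g2 T u1 u2 x \<and> x 0 = a \<and> x T = c"
    using T adm[OF u(1,3)] adm[OF u(2,4)] z by blast
qed

end

section \<open>Skew-symmetric matrices in an orthonormal eigenbasis\<close>

definition outer :: "real^'n \<Rightarrow> real^'n \<Rightarrow> real^'n^'n" where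
  "outer x y = (\<chi> i j. x $ i * y $ j)"

lemma outer_simps:
  "outer x y ** outer u v = (y \<bullet> u) *\<^sub>R outer x v"
  "transpose (outer x y) = outer y x"
  "A ** outer x y = outer (A *v x) y"
  "outer x y ** A = outer x (transpose A *v y)"
  "outer x y *v z = (y \<bullet> z) *\<^sub>R x"
  "outer (a *\<^sub>R x) y = a *\<^sub>R outer x y"
  "outer x (a *\<^sub>R y) = a *\<^sub>R outer x y"
  by (simp_all add: outer_def vec_eq_iff matrix_matrix_mult_def matrix_vector_mult_def inner_vec_def
      transpose_def sum_distrib_left sum_distrib_right mult_ac)

lemma transpose_sum: "transpose (\<Sum>i\<in>I. A i) = (\<Sum>i\<in>I. transpose (A i :: real^'n^'m))"
  by (simp add: transpose_def vec_eq_iff)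

lemma outer_sum_left: "outer (\<Sum>i\<in>I. u i) y = (\<Sum>i\<in>I. outer (u i) y)"
  by (simp add: outer_def vec_eq_iff sum_distrib_right)

definition wedge :: "real^'n \<Rightarrow> real^'n \<Rightarrow> real^'n^'n" where
  "wedge x y = outer x y - outer y x"

lemma wedge_in_so: "wedge x y \<in> so"
  by (simp add: so_def wedge_def transpose_diff outer_simps)

lemma wedge_swap: "wedge y x = - wedge x y"
  by (simp add: wedge_def)

lemma matrix_diff_rdist: "(A - B) ** C = A ** C - B ** C" for A B C :: "real^'n^'n"
  by (simp add: matrix_matrix_mult_def vec_eq_iff sum_subtractf algebra_simps)

lemma matrix_diff_ldist: "C ** (A - B) = C ** A - C ** B" for A B C :: "real^'n^'n"
  by (simp add: matrix_matrix_mult_def vec_eq_iff sum_subtractf algebra_simps)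

locale orthonormal_eigenbasis =
  fixes C :: "real^'n^'n" and e :: "'n \<Rightarrow> real^'n" and ev :: "'n \<Rightarrow> real"
  assumes orth: "e i \<bullet> e j = (if i = j then 1 else 0)"
    and eig: "C *v e i = ev i *\<^sub>R e i" and sym: "transpose C = C"
begin

lemma orthonormal_expansion: "x = (\<Sum>i\<in>UNIV. (x \<bullet> e i) *\<^sub>R e i)"
proof -
  have inj: "inj e"
    using orth by (metis injI zero_neq_one)
  have pw: "pairwise orthogonal (range e)"
    using orth by (auto simp: pairwise_def orthogonal_def)
  have n1: "norm v = 1" if "v \<in> range e" for v
    using that orth by (auto simp: norm_eq_1)
  have "independent (range e)"
    using n1[of 0] by (intro pairwise_orthogonal_independent pw) auto
  then have "span (range e) = UNIV"
    using inj card_ge_dim_independent[of "range e" UNIV] by (auto simp: card_image)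
  then have "(\<Sum>v\<in>range e. (x \<bullet> v) *\<^sub>R v) = x"
    by (intro orthonormal_basis_expand pw n1) auto
  then show ?thesis using inj by (simp add: sum.reindex)
qed

text \<open>Expand \<open>A\<close> in the products \<open>outer (e i) (e j)\<close>.
  Antisymmetrizing leaves a skew-symmetric matrix unchanged and turns each product into a
  wedge.\<close>

lemma so_subset_subspace:
  assumes V: "subspace V" and W: "\<And>i j. i \<noteq> j \<Longrightarrow> wedge (e i) (e j) \<in> V"
  shows "so \<subseteq> V"
proof
  fix A :: "real^'n^'n" assume A: "A \<in> so"
  have W': "wedge (e i) (e j) \<in> V" for i j
    using W[of i j] subspace_0[OF V] by (cases "i = j") (auto simp: wedge_def)
  define S where "S = (\<Sum>j\<in>UNIV. \<Sum>i\<in>UNIV. ((A *v e j) \<bullet> e i) *\<^sub>R outer (e i) (e j))"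
  have "S = (\<Sum>j\<in>UNIV. outer (A *v e j) (e j))"
    unfolding S_def
  proof (rule sum.cong[OF refl])
    fix j
    show "(\<Sum>i\<in>UNIV. ((A *v e j) \<bullet> e i) *\<^sub>R outer (e i) (e j)) = outer (A *v e j) (e j)"
      using arg_cong[OF orthonormal_expansion[of "A *v e j"], of "\<lambda>u. outer u (e j)"]
      by (simp add: outer_sum_left outer_simps)
  qed
  moreover have "(\<Sum>j\<in>UNIV. outer (A *v e j) (e j)) *v x = A *v x" for x
  proof -
    have sum_matrix_vector_mult: "(\<Sum>j\<in>I. B j) *v x = (\<Sum>j\<in>I. B j *v x)"
      for I :: "'n set" and B :: "'n \<Rightarrow> real^'n^'n"
      by (induction I rule: infinite_finite_induct) (auto simp: matrix_vector_mult_add_rdistrib)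
    have "(\<Sum>j\<in>UNIV. outer (A *v e j) (e j)) *v x = (\<Sum>j\<in>UNIV. (x \<bullet> e j) *\<^sub>R (A *v e j))"
      by (subst sum_matrix_vector_mult) (simp add: outer_simps inner_commute)
    also have "\<dots> = A *v (\<Sum>j\<in>UNIV. (x \<bullet> e j) *\<^sub>R e j)"
      by (simp add: matrix_vector_mult_scaleR linear_sum[OF matrix_vector_mul_linear])
    finally show ?thesis by (simp only: orthonormal_expansion[of x, symmetric])
  qed
  ultimately have SA: "S = A" by (simp add: matrix_eq)
  have "A = (1/2) *\<^sub>R (A - transpose A)" using A by (simp add: so_def flip: scaleR_2)
  also have "A - transpose A = S - transpose S" by (simp only: SA)
  also have "\<dots> = (\<Sum>j\<in>UNIV. \<Sum>i\<in>UNIV. ((A *v e j) \<bullet> e i) *\<^sub>R wedge (e i) (e j))"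
    by (simp add: S_def transpose_sum transpose_scalar outer_simps wedge_def
        scaleR_diff_right sum_subtractf)
  also have "(1/2) *\<^sub>R \<dots> \<in> V"
    by (intro subspace_scale subspace_sum V W')
  finally show "A \<in> V" .
qed

end

section \<open>Separating eigencomponents\<close>

text \<open>Applying \<open>A\<close> minus \<open>\<mu> j\<close> to the sum removes the summand
  \<open>j\<close> and rescales the others by nonzero factors.\<close>

lemma eigenvector_summands_in_invariant_subspace:
  fixes A :: "'a::real_vector \<Rightarrow> 'a"
  assumes "finite K" and A: "linear A" and V: "subspace V" and inv: "\<And>x. x \<in> V \<Longrightarrow> A x \<in> V"
    and eig: "\<And>k. k \<in> K \<Longrightarrow> A (v k) = \<mu> k *\<^sub>R v k" and "inj_on \<mu> K"
    and "(\<Sum>k\<in>K. v k) \<in> V" and "k \<in> K"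
  shows "v k \<in> V"
  using assms(1,5-)
proof (induction K arbitrary: v k)
  case empty
  then show ?case by simp
next
  case (insert j K)
  let ?s = "\<Sum>k\<in>insert j K. v k"
  have "A ?s - \<mu> j *\<^sub>R ?s = (\<Sum>k\<in>insert j K. A (v k) - \<mu> j *\<^sub>R v k)"
    by (simp add: linear_sum[OF A] scaleR_sum_right sum_subtractf)
  also have "\<dots> = (\<Sum>k\<in>K. (\<mu> k - \<mu> j) *\<^sub>R v k)"
    using insert.hyps insert.prems(1) by (simp add: scaleR_diff_left)
  finally have eq: "(\<Sum>k\<in>K. (\<mu> k - \<mu> j) *\<^sub>R v k) = A ?s - \<mu> j *\<^sub>R ?s" ..
  have s: "(\<Sum>k\<in>K. (\<mu> k - \<mu> j) *\<^sub>R v k) \<in> V"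
    unfolding eq using insert.prems(3) inv V by (intro subspace_diff subspace_scale) auto
  have K: "v i \<in> V" if i: "i \<in> K" for i
  proof -
    \<comment> \<open>The rescaled vectors keep their eigenvalues, so the induction hypothesis
      applies to them in place of \<open>v\<close>.\<close>
    have "(\<mu> i - \<mu> j) *\<^sub>R v i \<in> V"
    proof (rule insert.IH[OF _ _ s i])
      show "A ((\<mu> k - \<mu> j) *\<^sub>R v k) = \<mu> k *\<^sub>R (\<mu> k - \<mu> j) *\<^sub>R v k" if "k \<in> K" for k
        using insert.prems(1)[of k] that by (simp add: linear_cmul[OF A])
      show "inj_on \<mu> K" using insert.prems(2) by (rule inj_on_subset) auto
    qed
    moreover have "\<mu> i \<noteq> \<mu> j" using insert i by (auto simp: inj_on_def)
    ultimately show ?thesis using subspace_scale[OF V, of _ "inverse (\<mu> i - \<mu> j)"] by fastforce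
  qed
  then have "(\<Sum>k\<in>K. v k) \<in> V" by (intro subspace_sum V)
  then have "v j \<in> V"
    using subspace_diff[OF V insert.prems(3)] insert.hyps by fastforce
  with K insert.prems(4) show ?case by auto
qed

text \<open>After clearing denominators the difference of the two sides factors into
  \<open>a + b\<close>, \<open>x - y\<close> and \<open>x * y - a * b\<close> up to a constant;
  \<open>less\<close> excludes the last factor.\<close>

lemma moebius_product_inj:
  fixes a b x y :: real
  assumes pos: "a > 0" "b > 0" "x > 0" "y > 0" and less: "x * y < a * b"
    and eq: "(a - x) / (a + x) * ((b - x) / (b + x)) = (a - y) / (a + y) * ((b - y) / (b + y))"
  shows "x = y"
proof -
  have "((a - x) * (b - x)) * ((a + y) * (b + y)) = ((a - y) * (b - y)) * ((a + x) * (b + x))"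
    using eq pos by (simp add: frac_eq_eq)
  then have "2 * (a + b) * (x - y) * (x * y - a * b) = 0" by (simp add: algebra_simps)
  then show ?thesis using pos less by auto
qed

lemma outer_diff_left: "outer (x - y) z = outer x z - outer y z"
  by (simp add: outer_def vec_eq_iff algebra_simps)

lemma matrix_mul_scaleR: "(a *\<^sub>R A) ** B = a *\<^sub>R (A ** B)" "A ** (a *\<^sub>R B) = a *\<^sub>R (A ** B)"
  for A B :: "real^'n^'n"
  by (simp_all add: matrix_matrix_mult_def vec_eq_iff sum_distrib_left mult_ac)

section \<open>The Euler nonlinearity on the wedge basis\<close>

text \<open>\<open>M\<close> is the inverse inertia operator extended to a linear map on all
  matrices, so that the polarized drift becomes bilinear on the whole space.\<close>

locale positive_eigenbasis = orthonormal_eigenbasis +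
  fixes M :: "real^'n^'n \<Rightarrow> real^'n^'n"
  assumes pos: "ev i > 0" and inj_ev: "inj ev"
    and M: "linear M" and M_inertia: "\<And>X. X \<in> so \<Longrightarrow> M (inertia C X) = X"
begin

definition b :: "real^'n^'n \<Rightarrow> real^'n^'n \<Rightarrow> real^'n^'n" where
  "b X Y = M (commutator C (X ** Y))"

lemma linear_commutator: "linear (commutator C)"
  by (rule linearI)
     (simp_all add: commutator_def matrix_add_ldistrib matrix_add_rdist matrix_mul_scaleR scaleR_diff_right)

lemma bilinear_b: "bilinear b"
proof -
  note lin = linear_compose[OF _ linear_compose[OF linear_commutator M], unfolded o_def]
  have "linear (\<lambda>Y :: real^'n^'n. X ** Y)" "linear (\<lambda>Y :: real^'n^'n. Y ** X)" for X :: "real^'n^'n"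
    by (auto intro!: linearI simp: matrix_add_ldistrib matrix_add_rdist matrix_mul_scaleR)
  from this[THEN lin] show ?thesis
    by (simp add: bilinear_def b_def)
qed

definition E :: "'n \<Rightarrow> 'n \<Rightarrow> real^'n^'n" where "E i j = wedge (e i) (e j)"

lemma E_swap: "E j i = - E i j"
  unfolding E_def by (rule wedge_swap)

lemma E_mult:
  "E i j ** E k m = (e j \<bullet> e k) *\<^sub>R outer (e i) (e m) - (e j \<bullet> e m) *\<^sub>R outer (e i) (e k)
    - (e i \<bullet> e k) *\<^sub>R outer (e j) (e m) + (e i \<bullet> e m) *\<^sub>R outer (e j) (e k)"
  by (simp add: E_def wedge_def matrix_diff_rdist matrix_diff_ldist outer_simps
      matrix_vector_mult_diff_rdistrib outer_diff_left)

lemma commutator_outer: "commutator C (outer (e i) (e j)) = (ev i - ev j) *\<^sub>R outer (e i) (e j)"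
  by (simp add: commutator_def outer_simps eig sym scaleR_diff_left)

text \<open>The square of \<open>E i j\<close> is minus the projection onto the plane of
  \<open>e i\<close> and \<open>e j\<close>, which commutes with \<open>C\<close>: rotation in a
  principal plane is steady.\<close>

lemma b_steady:
  assumes "i \<noteq> j"
  shows "b (E i j) (E i j) = 0"
proof -
  have "E i j ** E i j = - outer (e i) (e i) - outer (e j) (e j)"
    using assms by (simp add: E_mult orth)
  then show ?thesis
    by (simp add: b_def linear_diff[OF linear_commutator] linear_neg[OF linear_commutator]
        commutator_outer linear_0[OF M])
qed

text \<open>One outer product survives in each order of multiplication. The commutator with
  \<open>C\<close> multiplies them by opposite factors, which yields a wedge, and the inertia
  operator scales this wedge by \<open>ev i + ev k\<close>.\<close>

lemma b_chain:
  assumes "i \<noteq> j" "j \<noteq> k" "i \<noteq> k"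
  shows "b (E i j) (E j k) + b (E j k) (E i j) = ((ev i - ev k) / (ev i + ev k)) *\<^sub>R E i k"
proof -
  have 1: "E i j ** E j k = outer (e i) (e k)" "E j k ** E i j = outer (e k) (e i)"
    using assms by (simp_all add: E_mult orth)
  have 2: "inertia C (E i k) = (ev i + ev k) *\<^sub>R E i k"
    by (simp add: inertia_def E_def wedge_def matrix_diff_rdist matrix_diff_ldist outer_simps eig sym
        algebra_simps)
  have "b (E i j) (E j k) + b (E j k) (E i j) = M ((ev i - ev k) *\<^sub>R E i k)"
    unfolding b_def 1 commutator_outer linear_add[OF M, symmetric]
    by (simp add: E_def wedge_def algebra_simps)
  also have "(ev i - ev k) *\<^sub>R E i k = ((ev i - ev k) / (ev i + ev k)) *\<^sub>R inertia C (E i k)"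
    using pos[of i] pos[of k] by (simp add: 2)
  also have "M \<dots> = ((ev i - ev k) / (ev i + ev k)) *\<^sub>R E i k"
    by (simp add: linear_cmul[OF M] M_inertia E_def wedge_in_so)
  finally show ?thesis .
qed

text \<open>Distinct eigenvalues make the coefficient in \<open>b_chain\<close> nonzero, so it can
  be divided out.\<close>

lemma chain_in:
  assumes V: "subspace V" and ext: "\<And>g w. g \<in> V \<Longrightarrow> b g g = 0 \<Longrightarrow> w \<in> V \<Longrightarrow> b g w + b w g \<in> V"
    and ijk: "i \<noteq> j" "j \<noteq> k" "i \<noteq> k" and "E i j \<in> V" "E j k \<in> V"
  shows "E i k \<in> V"
proof -
  have "((ev i - ev k) / (ev i + ev k)) *\<^sub>R E i k \<in> V"
    using ext[OF \<open>E i j \<in> V\<close> b_steady[OF ijk(1)] \<open>E j k \<in> V\<close>] by (simp add: b_chain[OF ijk])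
  moreover have "(ev i - ev k) / (ev i + ev k) \<noteq> 0"
    using injD[OF inj_ev, of i k] ijk pos[of i] pos[of k] by auto
  ultimately show ?thesis
    using subspace_scale[OF V, of _ "inverse ((ev i - ev k) / (ev i + ev k))"] by fastforce
qed

text \<open>The algebraic half of the argument, for any subspace with the closure property that
  \<open>J_extend\<close> gives to the jump directions.\<close>

lemma so_subset_closure:
  assumes V: "subspace V" and ext: "\<And>g w. g \<in> V \<Longrightarrow> b g g = 0 \<Longrightarrow> w \<in> V \<Longrightarrow> b g w + b w g \<in> V"
    and i12: "i1 \<noteq> i2" and largest: "\<And>k. k \<noteq> i1 \<Longrightarrow> k \<noteq> i2 \<Longrightarrow> ev k < ev i1 \<and> ev k < ev i2"
    and G1: "E i1 i2 \<in> V" and G2: "(\<Sum>k\<in>UNIV - {i1, i2}. E i1 k) \<in> V"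
  shows "so \<subseteq> V"
proof -
  define A where "A = (\<lambda>X. b (E i1 i2) X + b X (E i1 i2))"
  have A: "linear A"
    using bilinear_b unfolding A_def bilinear_def by (intro linear_compose_add) auto
  have AV: "A X \<in> V" if "X \<in> V" for X
    unfolding A_def by (rule ext[OF G1 b_steady[OF i12] that])
  define \<beta> where "\<beta> = (\<lambda>i k. (ev i - ev k) / (ev i + ev k))"
  have A1: "A (E i1 k) = - \<beta> i2 k *\<^sub>R E i2 k" if "k \<noteq> i1" "k \<noteq> i2" for k
  proof -
    have "A (E i1 k) = - (b (E i2 i1) (E i1 k) + b (E i1 k) (E i2 i1))"
      by (simp add: A_def E_swap[of i1 i2] bilinear_lneg[OF bilinear_b] bilinear_rneg[OF bilinear_b])
    then show ?thesis using b_chain[of i2 i1 k] that i12 by (simp add: \<beta>_def)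
  qed
  have A2: "A (E i2 k) = \<beta> i1 k *\<^sub>R E i1 k" if "k \<noteq> i1" "k \<noteq> i2" for k
    using b_chain[of i1 i2 k] that i12 by (simp add: A_def \<beta>_def)
  \<comment> \<open>\<open>A\<close> exchanges \<open>E i1 k\<close> and \<open>E i2 k\<close> up to
    factors, so \<open>A \<circ> A\<close> is diagonal on the summands of \<open>G2\<close>.\<close>
  have E1: "E i1 k \<in> V" if k: "k \<noteq> i1" "k \<noteq> i2" for k
  proof (rule eigenvector_summands_in_invariant_subspace[where A = "A \<circ> A" and K = "UNIV - {i1, i2}"
        and v = "E i1" and \<mu> = "\<lambda>k. - (\<beta> i1 k * \<beta> i2 k)"])
    show "inj_on (\<lambda>k. - (\<beta> i1 k * \<beta> i2 k)) (UNIV - {i1, i2})"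
    proof (rule inj_onI)
      fix k m assume km: "k \<in> UNIV - {i1, i2}" "m \<in> UNIV - {i1, i2}"
        and eq: "- (\<beta> i1 k * \<beta> i2 k) = - (\<beta> i1 m * \<beta> i2 m)"
      \<comment> \<open>The choice of the two largest eigenvalues enters here.\<close>
      have "ev k * ev m < ev i1 * ev i2"
        using km largest[of k] largest[of m] pos[of k] pos[of m] by (intro mult_strict_mono) auto
      then have "ev k = ev m"
        using moebius_product_inj[OF pos pos pos pos] eq unfolding \<beta>_def neg_equal_iff_equal by blast
      then show "k = m" using inj_ev by (simp add: inj_eq)
    qed
    show "(A \<circ> A) (E i1 k) = - (\<beta> i1 k * \<beta> i2 k) *\<^sub>R E i1 k" if "k \<in> UNIV - {i1, i2}" for k
      using that by (simp add: A1 A2 linear_cmul[OF A] linear_neg[OF A] mult.commute)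
  qed (use V A AV G2 k linear_compose[OF A A] in auto)
  have neg: "E j i \<in> V" if "E i j \<in> V" for i j
    using subspace_neg[OF V that] by (simp add: E_swap[of j i])
  note chain = chain_in[OF V ext]
  have E1': "E i1 k \<in> V" if "k \<noteq> i1" for k
    using E1 G1 that by (cases "k = i2") auto
  \<comment> \<open>The remaining wedges are chained through \<open>i1\<close>, from
    \<open>E i i1\<close> and \<open>E i1 j\<close>.\<close>
  have "E i j \<in> V" if "i \<noteq> j" for i j
  proof (cases "i = i1 \<or> j = i1")
    case True
    then show ?thesis using E1'[of j] neg[OF E1'[of i]] that by auto
  next
    case False
    then show ?thesis using chain[of i i1 j] neg[OF E1'[of i]] E1'[of j] that by auto
  qed
  then show ?thesis by (intro so_subset_subspace V) (simp add: E_def)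
qed

end

section \<open>Spectral data of the inertia matrix and the rigid body system\<close>

lemma exists_two_largest:
  fixes c :: "'n::finite \<Rightarrow> real"
  assumes "inj c" "CARD('n) \<ge> 2"
  obtains i j where "i \<noteq> j" "\<And>k. k \<noteq> i \<Longrightarrow> k \<noteq> j \<Longrightarrow> c k < c i \<and> c k < c j"
proof -
  have "Max (range c) \<in> range c" by (intro Max_in) auto
  then obtain i where "Max (range c) = c i" by (rule imageE)
  then have i: "c k \<le> c i" for k
    using Max_ge[of "range c" "c k"] by simp
  have ne: "UNIV - {i} \<noteq> {}"
  proof
    assume "UNIV - {i} = {}"
    then have "CARD('n) \<le> card {i}" by (intro card_mono) auto
    with assms(2) show False by simp
  qed
  then have "Max (c ` (UNIV - {i})) \<in> c ` (UNIV - {i})" by (intro Max_in) auto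
  then obtain j where j: "Max (c ` (UNIV - {i})) = c j" "j \<in> UNIV - {i}" by (rule imageE)
  have "c k \<le> c j" if "k \<noteq> i" for k
    unfolding j(1)[symmetric] using that by (intro Max_ge) auto
  then have "c k < c i \<and> c k < c j" if "k \<noteq> i" "k \<noteq> j" for k
    using i[of k] injD[OF assms(1), of k i] injD[OF assms(1), of k j] that by (force simp: less_le)
  then show ?thesis using that[of i j] j(2) by blast
qed

text \<open>One normalized eigenvector is chosen for each eigenvalue; self-adjointness of
  \<open>C\<close> makes them orthogonal, and positive definiteness makes the eigenvalues
  positive.\<close>

lemma exists_orthonormal_eigenbasis:
  fixes C :: "real^'n^'n"
  assumes C: "sym_pos_def C" and D: "distinct_eigenvalues C"
  obtains e ev where "orthonormal_eigenbasis C e ev" "inj ev" "\<And>i. ev i > 0"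
proof -
  have sym: "transpose C = C" using C by (simp add: sym_pos_def_def)
  have self_adj: "(C *v x) \<bullet> y = x \<bullet> (C *v y)" for x y
    by (metis sym dot_lmul_matrix transpose_matrix_vector)
  have "card (eigenvalues C) = CARD('n)" using D by (simp add: distinct_eigenvalues_def)
  moreover from this have "finite (eigenvalues C)" using card_ge_0_finite[of "eigenvalues C"] by simp
  ultimately obtain ev where ev: "bij_betw ev (UNIV :: 'n set) (eigenvalues C)"
    using finite_same_card_bij[of "UNIV :: 'n set" "eigenvalues C"] by auto
  have inj: "inj ev" using ev by (simp add: bij_betw_def)
  have "\<forall>i. \<exists>v. v \<noteq> 0 \<and> C *v v = ev i *\<^sub>R v"
    using ev unfolding bij_betw_def eigenvalues_def by blast
  then obtain v where v: "\<And>i. v i \<noteq> 0" "\<And>i. C *v v i = ev i *\<^sub>R v i" by metis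
  define e where "e = (\<lambda>i. v i /\<^sub>R norm (v i))"
  have eig: "C *v e i = ev i *\<^sub>R e i" for i
    by (simp add: e_def matrix_vector_mult_scaleR v)
  have n1: "e i \<bullet> e i = 1" for i
    using v(1)[of i] by (simp add: e_def dot_square_norm power2_eq_square)
  have orth: "e i \<bullet> e j = 0" if "i \<noteq> j" for i j
  proof -
    have "ev i * (e i \<bullet> e j) = ev j * (e i \<bullet> e j)"
      using self_adj[of "e i" "e j"] by (simp add: eig)
    then show ?thesis using inj that by (auto simp: inj_eq)
  qed
  have "ev i > 0" for i
  proof -
    have "e i \<noteq> 0" using n1[of i] by auto
    then have "e i \<bullet> (C *v e i) > 0" using C by (simp add: sym_pos_def_def)
    then show ?thesis by (simp add: eig n1)
  qed
  moreover have "orthonormal_eigenbasis C e ev"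
    using n1 orth eig sym by unfold_locales auto
  ultimately show ?thesis using that inj by blast
qed

text \<open>Trajectories stay in \<open>X\<close>, so only the values of the drift there matter;
  this passes from the quadratic extension to the rigid body drift.\<close>

lemma globally_controllable_cong:
  assumes "\<And>x. x \<in> X \<Longrightarrow> f x = f' x"
  shows "globally_controllable X f g1 g2 = globally_controllable X f' g1 g2"
proof -
  have "controlled_trajectory X f g1 g2 T u1 u2 z = controlled_trajectory X f' g1 g2 T u1 u2 z"
    for T u1 u2 z
    unfolding controlled_trajectory_def
    by (intro conj_cong refl ball_cong has_integral_cong) (use assms in fastforce)
  then show ?thesis by (simp add: globally_controllable_def)
qed

theorem theorem3p1:
  fixes C :: "real^'n^'n"
  assumes "CARD('n) \<ge> 3"
    and "sym_pos_def C"
    and "distinct_eigenvalues C"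
  shows "\<exists>G1\<in>so. \<exists>G2\<in>so. \<forall>\<nu>\<ge>0. globally_controllable so (rigid_body_drift C \<nu>) G1 G2"
proof -
  obtain e ev where e: "orthonormal_eigenbasis C e ev" "inj ev" "\<And>i. ev i > 0"
    using exists_orthonormal_eigenbasis assms(2,3) by blast
  have inj: "inj_on (inertia C) so"
    using bij_betw_inertia[OF assms(2)] by (simp add: bij_betw_def)
  then obtain M where Minv: "range M \<subseteq> so" "linear M" "\<And>X. X \<in> so \<Longrightarrow> M (inertia C X) = X"
    using linear_exists_left_inverse_on[OF linear_inertia subspace_so, of C] by blast
  \<comment> \<open>A linear projection onto \<open>so\<close>: it extends the damping term to all
    matrices with values in \<open>so\<close>, as the confinement to \<open>so\<close>
    requires.\<close>
  obtain P where P: "range P \<subseteq> so" "linear P" "\<And>X. X \<in> so \<Longrightarrow> P (X :: real^'n^'n) = X"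
    using linear_exists_left_inverse_on[OF linear_ident subspace_so inj_on_id2] by blast
  interpret positive_eigenbasis C e ev M
    using e Minv by (simp add: positive_eigenbasis_def positive_eigenbasis_axioms_def)
  obtain i1 i2 where i12: "i1 \<noteq> i2" "\<And>k. k \<noteq> i1 \<Longrightarrow> k \<noteq> i2 \<Longrightarrow> ev k < ev i1 \<and> ev k < ev i2"
    using exists_two_largest[OF e(2)] assms(1) by auto
  \<comment> \<open>The directions are fixed before \<open>\<nu>\<close>, so that one pair serves
    all damping coefficients.\<close>
  define G1 where "G1 = E i1 i2"
  define G2 where "G2 = (\<Sum>k\<in>UNIV - {i1, i2}. E i1 k)"
  have G: "G1 \<in> so" "G2 \<in> so"
    by (auto simp: G1_def G2_def E_def wedge_in_so intro!: subspace_sum subspace_so)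
  have "globally_controllable so (rigid_body_drift C \<nu>) G1 G2" for \<nu>
  proof -
    define l where "l = (\<lambda>X. - \<nu> *\<^sub>R P X)"
    have l: "linear l" unfolding l_def by (intro linear_compose_scale_right P)
    interpret qc: quadratic_control b l G1 G2
      by (rule quadratic_control.intro[OF bilinear_b l])
    have "so \<subseteq> qc.J"
      by (rule so_subset_closure[OF subspace_jump_directions qc.J_extend i12])
         (use qc.controls_in_J in \<open>auto simp: G1_def G2_def\<close>)
    moreover have "l X \<in> so" for X
      unfolding l_def using P(1) by (intro subspace_scale subspace_so) auto
    ultimately have gc: "globally_controllable so qc.f G1 G2"
      using Minv(1) G by (intro qc.globally_controllable_if_jump_directions subspace_so) (auto simp: b_def)
    have "qc.f X = rigid_body_drift C \<nu> X" if X: "X \<in> so" for X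
    proof -
      have "commutator C (X ** X) \<in> inertia C ` so"
        using commutator_sq_in_so[OF assms(2) X] bij_betw_inertia[OF assms(2)] by (simp add: bij_betw_def)
      then obtain Y where "Y \<in> so" "commutator C (X ** X) = inertia C Y" by blast
      then show ?thesis
        by (simp add: rigid_body_drift_def inertia_inv_def inv_into_f_f[OF inj] b_def l_def Minv P X)
    qed
    then have "globally_controllable so qc.f G1 G2 = globally_controllable so (rigid_body_drift C \<nu>) G1 G2"
      by (rule globally_controllable_cong)
    with gc show ?thesis by (rule iffD1[rotated])
  qed
  with G show ?thesis by blast
qed

end
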